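(* Let $n$ be a positive integer and $0\le j_1<j_2<\dots<j_{n-1}\le 2n-3$ integers with $j_{n-1}<2n-3-j_1$. Then $$\ast(n;j_1,\dots,j_{n-1})=\sum_{l=2n-3-j_1}^{2n-3}(-1)^{l+1}\binom{l+1}{2n-j_1-2}\,\ast(n;j_2,\dots,j_{n-1},l).$$
   Context: An alternating sign triangle (AST) of order $n$ is a triangular array $(a_{i,j})_{1\le i\le n,\ i\le j\le 2n-i}$ (row $i$ has entries $a_{i,i},\dots,a_{i,2n-i}$; entries with the same $j$ form column $j$; there are $2n-1$ columns, the central one being column $n$) with entries in $\{0,1,-1\}$ such that: (1) the non-zero entries alternate in sign in each row and in each column; (2) every row sum is $1$; (3) the topmost non-zero entry of each column (if any) is $1$. A $1$-column is a column with sum $1$ (the central column is always one). Positions of non-central columns are counted from the left starting with $0$, disregarding the central column (so range $0,\dots,2n-3$). For integers $0\le k_1<\dots<k_{n-1}\le 2n-3$, $\ast(n;k_1,\dots,k_{n-1})$ denotes the number of ASTs of order $n$ whose non-central $1$-columns are exactly those in positions $k_1,\dots,k_{n-1}$. *)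

theory Defs
  imports Complex_Main
begin

definition alternates :: "(nat \<Rightarrow> int) \<Rightarrow> bool" where
  "alternates f \<longleftrightarrow>
     (\<forall>i k. i < k \<and> f i \<noteq> 0 \<and> f k \<noteq> 0 \<and> (\<forall>m. i < m \<and> m < k \<longrightarrow> f m = 0) \<longrightarrow> f k = - f i)"

definition triangle :: "nat \<Rightarrow> (nat \<times> nat) set" where
  "triangle n = {(i, j). 1 \<le> i \<and> i \<le> n \<and> i \<le> j \<and> j \<le> 2 * n - i}"

(* A triangular array is represented by a total function that vanishes outside the triangle.
   This makes the representation unique, so that arrays can be counted with card, and
   the additional zeros do not affect the conditions on signs and sums. *)
definition AST :: "nat \<Rightarrow> (nat \<Rightarrow> nat \<Rightarrow> int) \<Rightarrow> bool" where
  "AST n a \<longleftrightarrow>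
     (\<forall>i j. (i, j) \<notin> triangle n \<longrightarrow> a i j = 0) \<and>
     (\<forall>(i, j) \<in> triangle n. a i j \<in> {0, 1, -1}) \<and>
     (\<forall>i \<in> {1..n}. alternates (\<lambda>j. a i j)) \<and>
     (\<forall>j \<in> {1..2 * n - 1}. alternates (\<lambda>i. a i j)) \<and>
     (\<forall>i \<in> {1..n}. (\<Sum>j = i..2 * n - i. a i j) = 1) \<and>
     (\<forall>(i, j) \<in> triangle n. a i j \<noteq> 0 \<and> (\<forall>i' < i. a i' j = 0) \<longrightarrow> a i j = 1)"

definition one_column :: "nat \<Rightarrow> (nat \<Rightarrow> nat \<Rightarrow> int) \<Rightarrow> nat \<Rightarrow> bool" where
  "one_column n a j \<longleftrightarrow> (\<Sum>i = 1..n. a i j) = 1"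

(* The index in {1..2 * n - 1} of the non-central column in position p, where positions are
   counted from 0 and the central column n is skipped. *)
definition column_at :: "nat \<Rightarrow> nat \<Rightarrow> nat" where
  "column_at n p = (if p + 1 < n then p + 1 else p + 2)"

(* Positions range over 0, ..., 2 * n - 3; the form p < 2 * n - 2 is also correct for n = 1,
   where there is no non-central column. *)
definition one_column_positions :: "nat \<Rightarrow> (nat \<Rightarrow> nat \<Rightarrow> int) \<Rightarrow> nat set" where
  "one_column_positions n a = {p. p < 2 * n - 2 \<and> one_column n a (column_at n p)}"

(* The list ks is meant to be strictly increasing, of length n - 1, with entries at most 2 * n - 3. *)
definition ast_count :: "nat \<Rightarrow> nat list \<Rightarrow> nat" where
  "ast_count n ks = card {a. AST n a \<and> one_column_positions n a = set ks}"

end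

theory Submission
  imports Defs
begin

text \<open>Record an alternating sign triangle by the sets \<open>S\<^sub>r\<close> of columns whose sum over the first \<open>r\<close> rows is
  \<open>1\<close>. Consecutive sets interlace, and they agree on all columns that have already ended. Hence, as long
  as no element of \<open>S\<^sub>r\<close> is a finished column, the number of ways to reach \<open>S\<^sub>r\<close> is the number
  \<open>\<alpha>(r; S\<^sub>r)\<close> of monotone triangles with bottom row \<open>S\<^sub>r\<close>, and a largest element that has been finished for \<open>t\<close>
  rows corresponds to the \<open>t\<close>-th difference of \<open>\<alpha>\<close> in its last argument.

  Put \<open>i = j\<^sub>1 + 1\<close>, the leftmost 1-column. Below row \<open>i\<close> both sides of the claimed identity evolve by the same
  rows, since column \<open>i\<close> and the columns from \<open>2n - i\<close> on have ended. In row \<open>i\<close> the identity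
  says that \<open>\<alpha>(i; k\<^sub>1, \<dots>, k\<^sub>i) = (-1)\<^bsup>i-1\<^esup> \<alpha>(i; k\<^sub>2, \<dots>, k\<^sub>i, k\<^sub>1 - i)\<close>, after expanding the right-hand side, which
  has degree less than \<open>i\<close> in the last argument, into differences at \<open>2n - i\<close>.

  For the rotation, \<open>\<alpha>(n; k) = \<Prod>\<^bsub>p<q\<^esub> (1 + E\<^sub>p \<Delta>\<^sub>q) g\<^sub>n(k)\<close> where the antisymmetric function \<open>g\<^sub>n\<close> is obtained
  from \<open>1\<close> by \<open>n\<close> Gelfand-Tsetlin summations and is annihilated by every \<open>e\<^sub>i(\<Delta>\<^sub>1, \<dots>, \<Delta>\<^sub>n)\<close> with \<open>i > 0\<close>. So
  \<open>e\<^sub>i(\<Delta>\<^sub>2, \<dots>, \<Delta>\<^sub>n) = (-\<Delta>\<^sub>1)\<^sup>i\<close> on \<open>g\<^sub>n\<close>, and both sides reduce to the operator \<open>(1 + E\<^sub>1 \<Delta>\<^sub>1)\<^sup>-\<^sup>1\<close>.\<close>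

section \<open>Signed sums\<close>

text \<open>An oriented sum: exchanging the end points changes the sign. Splitting and telescoping
  then hold for end points in any order, and functions built from such sums are defined on all
  integer tuples.\<close>

definition signed_sum :: "int \<Rightarrow> int \<Rightarrow> (int \<Rightarrow> int) \<Rightarrow> int" where
  "signed_sum a b f = (\<Sum>l\<in>{a..<b}. f l) - (\<Sum>l\<in>{b..<a}. f l)"

lemma signed_sum_same [simp]: "signed_sum a a f = 0"
  by (simp add: signed_sum_def)

lemma signed_sum_swap: "signed_sum b a f = - signed_sum a b f"
  by (simp add: signed_sum_def)

lemma signed_sum_Suc: "signed_sum a (b + 1) f = signed_sum a b f + f b"
proof (cases "a \<le> b")
  case True
  then have "{a..<b+1} = insert b {a..<b}" "{b+1..<a} = {}" "{b..<a} = {}" by auto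
  then show ?thesis by (simp add: signed_sum_def)
next
  case False
  then have "{b..<a} = insert b {b+1..<a}" "{a..<b+1} = {}" "{a..<b} = {}" by auto
  then show ?thesis by (simp add: signed_sum_def)
qed

text \<open>Induction in both directions from \<open>a\<close>; it spares a case distinction on the
  order of the end points of a signed sum.\<close>

lemma signed_sum_induct:
  assumes "P a" "\<And>b. P b \<longleftrightarrow> P (b + 1)"
  shows "P (b::int)"
proof (cases "a \<le> b")
  case True
  then show ?thesis
    by (induction b rule: int_ge_induct) (use assms in auto)
next
  case False
  then have "b \<le> a" by simp
  then show ?thesis
  proof (induction b rule: int_le_induct)
    case base
    show ?case by (fact assms(1))
  next
    case (step i)
    then show ?case using assms(2)[of "i - 1"] by simp
  qed
qed

lemma signed_sum_split: "signed_sum a c f = signed_sum a b f + signed_sum b c f"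
  by (rule signed_sum_induct[where a = b]) (simp_all add: signed_sum_Suc)

lemma signed_sum_telescope: "signed_sum a b (\<lambda>l. F l - F (l + 1)) = F a - F b"
  by (rule signed_sum_induct[where a = a]) (auto simp: signed_sum_Suc)

lemma signed_sum_cong: "(\<And>l. f l = g l) \<Longrightarrow> signed_sum a b f = signed_sum a b g"
  by (simp add: signed_sum_def)

lemma signed_sum_add: "signed_sum a b (\<lambda>l. f l + g l) = signed_sum a b f + signed_sum a b g"
  by (simp add: signed_sum_def sum.distrib)

lemma signed_sum_diff: "signed_sum a b (\<lambda>l. f l - g l) = signed_sum a b f - signed_sum a b g"
  by (simp add: signed_sum_def sum_subtractf)

lemma signed_sum_uminus: "signed_sum a b (\<lambda>l. - f l) = - signed_sum a b f"
  by (simp add: signed_sum_def sum_negf)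

lemma signed_sum_comm: "signed_sum a b (\<lambda>l. signed_sum c d (\<lambda>m. f l m)) = signed_sum c d (\<lambda>m. signed_sum a b (\<lambda>l. f l m))"
  by (rule signed_sum_induct[where a = a and b = b]) (simp_all add: signed_sum_add signed_sum_Suc signed_sum_def[of c d "\<lambda>_. 0"])

lemma signed_sum_antisym:
  assumes "\<And>l m. f l m = - f m l"
  shows "signed_sum a b (\<lambda>l. signed_sum a b (f l)) = 0"
proof -
  have "signed_sum a b (\<lambda>l. signed_sum a b (f l)) = signed_sum a b (\<lambda>m. signed_sum a b (\<lambda>l. f l m))"
    by (rule signed_sum_comm)
  also have "\<dots> = signed_sum a b (\<lambda>m. signed_sum a b (\<lambda>l. - f m l))"
    by (intro arg_cong[where f = "signed_sum a b"] ext) (rule assms)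
  also have "\<dots> = - signed_sum a b (\<lambda>l. signed_sum a b (f l))"
    by (simp add: signed_sum_uminus)
  finally show ?thesis by simp
qed

section \<open>Difference operators on functions of integer tuples\<close>

text \<open>With \<open>\<Delta>\<^sub>p\<close> the forward difference and \<open>E\<^sub>p\<close> the shift in the \<open>p\<close>-th variable, \<open>esym i\<close> is the
  elementary symmetric polynomial \<open>e\<^sub>i(\<Delta>\<^sub>1, \<dots>, \<Delta>\<^sub>n)\<close>, where \<open>n\<close> is the length of the argument list.\<close>

fun esym :: "nat \<Rightarrow> (int list \<Rightarrow> int) \<Rightarrow> int list \<Rightarrow> int" where
  "esym 0 f [] = f []"
| "esym (Suc i) f [] = 0"
| "esym 0 f (k # ks) = esym 0 (\<lambda>l. f (k # l)) ks"
| "esym (Suc i) f (k # ks) = esym (Suc i) (\<lambda>l. f (k # l)) ks + esym i (\<lambda>l. f ((k + 1) # l) - f (k # l)) ks"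

lemma esym_0 [simp]: "esym 0 f ks = f ks"
  by (induction ks arbitrary: f) auto

lemma esym_0_fun: "esym 0 f = f"
  by (simp add: fun_eq_iff)

lemma esym_gt: "length ks < i \<Longrightarrow> esym i f ks = 0"
  by (induction i f ks rule: esym.induct) auto

lemma esym_cong:
  "(\<And>l. length l = length ks \<Longrightarrow> f l = g l) \<Longrightarrow> esym i f ks = esym i g ks"
proof (induction ks arbitrary: i f g)
  case Nil
  then show ?case by (cases i) auto
next
  case (Cons k ks)
  show ?case
  proof (cases i)
    case (Suc j)
    have "esym (Suc j) (\<lambda>l. f (k # l)) ks = esym (Suc j) (\<lambda>l. g (k # l)) ks"
      "esym j (\<lambda>l. f ((k + 1) # l) - f (k # l)) ks = esym j (\<lambda>l. g ((k + 1) # l) - g (k # l)) ks"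
      by (rule Cons.IH; simp add: Cons.prems)+
    then show ?thesis by (simp add: Suc)
  qed (simp add: Cons.prems)
qed

lemma esym_add: "esym i (\<lambda>l. f l + g l) ks = esym i f ks + esym i g ks"
proof (induction ks arbitrary: i f g)
  case Nil
  then show ?case by (cases i) auto
next
  case (Cons k ks)
  show ?case
  proof (cases i)
    case (Suc j)
    have "esym j (\<lambda>l. f ((k + 1) # l) + g ((k + 1) # l) - (f (k # l) + g (k # l))) ks
        = esym j (\<lambda>l. (f ((k + 1) # l) - f (k # l)) + (g ((k + 1) # l) - g (k # l))) ks"
      by (rule esym_cong) simp
    then show ?thesis by (simp add: Suc Cons.IH)
  qed simp
qed

lemma esym_zero: "esym i (\<lambda>l. 0) ks = 0"
  using esym_add[of i "\<lambda>_. 0" "\<lambda>_. 0" ks] by simp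

lemma esym_uminus: "esym i (\<lambda>l. - f l) ks = - esym i f ks"
  using esym_add[of i f "\<lambda>l. - f l" ks] by (simp add: esym_zero)

lemma esym_diff: "esym i (\<lambda>l. f l - g l) ks = esym i f ks - esym i g ks"
  using esym_add[of i f "\<lambda>l. - g l" ks] by (simp add: esym_uminus)

lemma esym_sum: "finite I \<Longrightarrow> esym i (\<lambda>l. \<Sum>j\<in>I. f j l) ks = (\<Sum>j\<in>I. esym i (f j) ks)"
  by (induction I rule: finite_induct) (simp_all add: esym_zero esym_add)

lemma esym_Nil: "esym i f [] = (if i = 0 then f [] else 0)"
  by (cases i) simp_all

lemma esym_commute: "esym i (esym j f) ks = esym j (esym i f) ks"
proof (induction ks arbitrary: i j f)
  case Nil
  then show ?case
    by (simp add: esym_Nil)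
next
  case (Cons k ks)
  show ?case
  proof (cases "i = 0 \<or> j = 0")
    case False
    then obtain i' j' where ij: "i = Suc i'" "j = Suc j'"
      by (cases i; cases j) auto
    \<comment> \<open>The four terms are sorted by the power of the difference in the first
      variable: 0, twice 1, and 2. Exchanging \<open>i\<close> and \<open>j\<close> swaps the two
      middle ones.\<close>
    have 1: "esym (Suc i) (esym (Suc j) f) (k # ks) =
      esym (Suc i) (esym (Suc j) (\<lambda>l. f (k # l))) ks + esym (Suc i) (esym j (\<lambda>l. f ((k + 1) # l) - f (k # l))) ks
      + esym i (esym (Suc j) (\<lambda>l. f ((k + 1) # l) - f (k # l))) ks
      + esym i (esym j (\<lambda>l. (f ((k + 1 + 1) # l) - f ((k + 1) # l)) - (f ((k + 1) # l) - f (k # l)))) ks" for i j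
      by (simp only: esym.simps esym_add esym_diff esym_diff[abs_def])
    show ?thesis
      unfolding ij 1 Cons.IH[of "Suc i'" "Suc j'"] Cons.IH[of "Suc i'" j'] Cons.IH[of i' "Suc j'"] Cons.IH[of i' j']
      by simp
  next
    case True
    then show ?thesis
      by (elim disjE) (simp_all add: esym_0_fun)
  qed
qed

section \<open>Antisymmetric functions, described by adjacent transpositions\<close>

definition antisym_fun :: "nat \<Rightarrow> (int list \<Rightarrow> int) \<Rightarrow> bool" where
  "antisym_fun n f \<longleftrightarrow> (\<forall>xs a b ys. length xs + 2 + length ys = n \<longrightarrow> f (xs @ a # b # ys) = - f (xs @ b # a # ys))"

lemma antisym_funD: "antisym_fun n f \<Longrightarrow> length xs + 2 + length ys = n \<Longrightarrow> f (xs @ a # b # ys) = - f (xs @ b # a # ys)"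
  unfolding antisym_fun_def by blast

lemma antisym_fun_head: "antisym_fun n f \<Longrightarrow> 2 + length ys = n \<Longrightarrow> f (a # b # ys) = - f (b # a # ys)"
  using antisym_funD[of n f "[]" ys a b] unfolding append_Nil list.size by (metis add_0)

lemma antisym_fun_Cons: "antisym_fun (Suc n) f \<Longrightarrow> antisym_fun n (\<lambda>l. f (k # l))"
  unfolding antisym_fun_def
proof (intro allI impI)
  fix xs ys :: "int list" and a b
  assume "\<forall>xs a b ys. length xs + 2 + length ys = Suc n \<longrightarrow> f (xs @ a # b # ys) = - f (xs @ b # a # ys)"
    "length xs + 2 + length ys = n"
  from this(1)[rule_format, of "k # xs" ys a b] this(2)
  show "f (k # xs @ a # b # ys) = - f (k # xs @ b # a # ys)" by simp
qed

lemma antisym_fun_diff: "antisym_fun n f \<Longrightarrow> antisym_fun n g \<Longrightarrow> antisym_fun n (\<lambda>l. f l - g l)"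
  unfolding antisym_fun_def
proof (intro allI impI)
  fix xs ys :: "int list" and a b
  assume "\<forall>xs a b ys. length xs + 2 + length ys = n \<longrightarrow> f (xs @ a # b # ys) = - f (xs @ b # a # ys)"
    "\<forall>xs a b ys. length xs + 2 + length ys = n \<longrightarrow> g (xs @ a # b # ys) = - g (xs @ b # a # ys)"
    "length xs + 2 + length ys = n"
  from this(1)[rule_format, OF this(3), of a b] this(2)[rule_format, OF this(3), of a b]
  show "f (xs @ a # b # ys) - g (xs @ a # b # ys) = - (f (xs @ b # a # ys) - g (xs @ b # a # ys))"
    by linarith
qed

lemma antisym_fun_sum: "(\<And>i. i \<in> I \<Longrightarrow> antisym_fun n (f i)) \<Longrightarrow> antisym_fun n (\<lambda>l. \<Sum>i\<in>I. f i l)"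
  unfolding antisym_fun_def sum_negf[symmetric] by (intro allI impI sum.cong refl) blast

text \<open>A symmetric polynomial in the differences commutes with exchanging two variables. The
  prefix \<open>xs\<close> is peeled off until the exchanged pair stands at the head.\<close>

lemma esym_antisym_fun: "antisym_fun n f \<Longrightarrow> antisym_fun n (esym i f)"
proof -
  have "length xs + 2 + length ys = n \<Longrightarrow> antisym_fun n f \<Longrightarrow> esym i f (xs @ a # b # ys) = - esym i f (xs @ b # a # ys)"
    for xs ys a b
  proof (induction xs arbitrary: i n f)
    case Nil
    then have sw: "f (x # y # l) = - f (y # x # l)" if "length l = length ys" for l x y
      using antisym_fun_head[of n f l x y] that by simp
    have sw': "esym i (\<lambda>l. f (x # y # l)) ys = - esym i (\<lambda>l. f (y # x # l)) ys" for x y i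
      unfolding esym_uminus[symmetric] by (rule esym_cong) (rule sw)
    show ?case
    proof (cases i)
      case (Suc j)
      then show ?thesis
        \<comment> \<open>A term with differences in both exchanged variables occurs only from
          \<open>i = 2\<close> on, hence the split on \<open>j\<close>.\<close>
        by (cases j) (simp_all add: esym_diff sw'[where x = b and y = a] sw'[where x = "b + 1" and y = a] sw'[where x = b and y = "a + 1"]
            sw'[where x = "b + 1" and y = "a + 1"] sw[of ys b a] sw[of ys "b + 1" a] sw[of ys b "a + 1"])
    qed (simp add: sw[of ys b a])
  next
    case (Cons x xs)
    then have n: "length xs + 2 + length ys = n - 1" and nn: "n = Suc (n - 1)" by auto
    have a: "antisym_fun (n - 1) (\<lambda>l. f (k # l))" for k
      using Cons.prems(2) nn antisym_fun_Cons by metis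
    show ?case
    proof (cases i)
      case 0
      then show ?thesis using antisym_funD[OF Cons.prems(2), of "x # xs" ys a b] Cons.prems(1) by simp
    next
      case (Suc j)
      then show ?thesis
        using Cons.IH[OF n a, of "Suc j"] Cons.IH[OF n antisym_fun_diff[OF a a], of j "x+1" x] by simp
    qed
  qed
  then show "antisym_fun n f \<Longrightarrow> antisym_fun n (esym i f)"
    unfolding antisym_fun_def[of _ "esym i f"] by blast
qed

text \<open>Summation over the bottom row of a Gelfand-Tsetlin pattern; an operator from \<open>n\<close> to \<open>n + 1\<close> variables.\<close>

fun gt_sum :: "(int list \<Rightarrow> int) \<Rightarrow> int list \<Rightarrow> int" where
  "gt_sum g [] = 0"
| "gt_sum g [k] = g []"
| "gt_sum g (k1 # k2 # ks) = signed_sum k1 k2 (\<lambda>l. gt_sum (\<lambda>m. g (l # m)) (k2 # ks))"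

lemma gt_sum_cong:
  "(\<And>l. Suc (length l) = length ks \<Longrightarrow> f l = g l) \<Longrightarrow> gt_sum f ks = gt_sum g ks"
proof (induction f ks arbitrary: g rule: gt_sum.induct)
  case (3 f k1 k2 ks)
  show ?case
    unfolding gt_sum.simps by (intro signed_sum_cong 3) (use 3(2) in simp)
qed simp_all

lemma gt_sum_diff: "gt_sum (\<lambda>l. f l - g l) ks = gt_sum f ks - gt_sum g ks"
proof (induction f ks arbitrary: g rule: gt_sum.induct)
  case (3 f k1 k2 ks)
  show ?case
    unfolding gt_sum.simps 3 signed_sum_diff by simp
qed simp_all

lemma gt_sum_uminus: "gt_sum (\<lambda>l. - f l) ks = - gt_sum f ks"
  using gt_sum_diff[of f f ks] gt_sum_diff[of "\<lambda>l. f l - f l" f ks] by simp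

lemma gt_sum_sum: "finite I \<Longrightarrow> gt_sum (\<lambda>l. \<Sum>i\<in>I. f i l) ks = (\<Sum>i\<in>I. gt_sum (f i) ks)"
proof (induction I rule: finite_induct)
  case empty
  show ?case using gt_sum_diff[of "\<lambda>_. 0" "\<lambda>_. 0" ks] by simp
next
  case (insert i I)
  then show ?case
    using gt_sum_diff[of "\<lambda>l. \<Sum>j\<in>insert i I. f j l" "f i" ks] by simp
qed

text \<open>The first variable occurs only as the lower end of the outermost sum, so a difference in
  it removes that sum and fixes its index at \<open>k\<close>.\<close>

lemma gt_sum_head:
  assumes "m \<noteq> []"
  shows "gt_sum g ((k + 1) # m) - gt_sum g (k # m) = - gt_sum (\<lambda>l. g (k # l)) m"
proof -
  obtain k2 ks where m: "m = k2 # ks" using assms by (cases m) auto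
  have "signed_sum (k + 1) k2 F - signed_sum k k2 F = - F k" for F
    using signed_sum_Suc[of k2 k F] by (simp add: signed_sum_swap[of _ k2])
  then show ?thesis by (simp add: m)
qed

text \<open>The inner range from \<open>a\<close> to \<open>c\<close> is split at \<open>b\<close>.
  The part over the square from \<open>a\<close> to \<open>b\<close> vanishes by antisymmetry, and
  the rest only has its outer range reversed.\<close>

lemma gt_sum_antisym_fun_head:
  assumes "antisym_fun n g" "Suc (length ys) = n"
  shows "gt_sum g (a # b # ys) = - gt_sum g (b # a # ys)"
proof (cases ys)
  case Nil
  then show ?thesis by (simp add: signed_sum_swap[of b a])
next
  case (Cons c zs)
  define Q where "Q l m = gt_sum (\<lambda>r. g (l # m # r)) (c # zs)" for l m
  have "gt_sum (\<lambda>r. g (l # m # r)) (c # zs) = gt_sum (\<lambda>r. - g (m # l # r)) (c # zs)" for l m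
    by (rule gt_sum_cong, rule antisym_fun_head[OF assms(1)]) (use assms(2) Cons in simp)
  then have Q: "Q l m = - Q m l" for l m
    unfolding Q_def gt_sum_uminus by blast
  have "gt_sum g (b # a # ys) = signed_sum b a (\<lambda>l. signed_sum a c (Q l))"
    by (simp add: Cons Q_def[abs_def])
  also have "\<dots> = - signed_sum a b (\<lambda>l. signed_sum a b (Q l) + signed_sum b c (Q l))"
    using signed_sum_split[of a c _ b] signed_sum_swap[of b a] by simp
  also have "\<dots> = - signed_sum a b (\<lambda>l. signed_sum b c (Q l))"
    by (simp add: signed_sum_add signed_sum_antisym[OF Q])
  finally show ?thesis
    by (simp add: Cons Q_def[abs_def])
qed

lemma gt_sum_antisym_fun:
  assumes "antisym_fun n g"
  shows "antisym_fun (Suc n) (gt_sum g)"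
proof -
  have "length xs + 2 + length ys = Suc n \<Longrightarrow> antisym_fun n g \<Longrightarrow> gt_sum g (xs @ a # b # ys) = - gt_sum g (xs @ b # a # ys)"
    for xs ys a b n and g
  proof (induction xs arbitrary: n g)
    case Nil
    then show ?case using gt_sum_antisym_fun_head[of n g ys a b] by simp
  next
    case (Cons x xs)
    obtain n' where n': "n = Suc n'" "length xs + 2 + length ys = Suc n'"
      using Cons.prems(1) by (cases n) auto
    have a: "antisym_fun n' (\<lambda>l. g (k # l))" for k
      using Cons.prems(2) n' antisym_fun_Cons by blast
    note IH = Cons.IH[OF n'(2) a]
    show ?case
    proof (cases xs)
      case Nil
      have alt: "gt_sum (\<lambda>m. g (l # m)) (b # a # ys) = - gt_sum (\<lambda>m. g (l # m)) (a # b # ys)" for l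
        using IH[of l] Nil by simp
      \<comment> \<open>After the exchange the outermost range from \<open>x\<close> ends at
        \<open>b\<close> instead of \<open>a\<close>. The discrepancy is this sum of an
        antisymmetric function over a square.\<close>
      have "signed_sum a b (\<lambda>l. gt_sum (\<lambda>m. g (l # m)) (a # b # ys)) =
          signed_sum a b (\<lambda>l. signed_sum a b (\<lambda>l'. gt_sum (\<lambda>m. g (l # l' # m)) (b # ys)))"
        by simp
      also have "\<dots> = 0"
      proof (rule signed_sum_antisym)
        fix l l'
        have "gt_sum (\<lambda>m. g (l # l' # m)) (b # ys) = gt_sum (\<lambda>m. - g (l' # l # m)) (b # ys)"
          by (rule gt_sum_cong, rule antisym_fun_head[OF Cons.prems(2)]) (use n' Nil in simp)
        then show "gt_sum (\<lambda>m. g (l # l' # m)) (b # ys) = - gt_sum (\<lambda>m. g (l' # l # m)) (b # ys)"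
          by (simp add: gt_sum_uminus)
      qed
      finally have 0: "signed_sum a b (\<lambda>l. gt_sum (\<lambda>m. g (l # m)) (a # b # ys)) = 0" .
      show ?thesis
        using signed_sum_split[of x b "\<lambda>l. gt_sum (\<lambda>m. g (l # m)) (a # b # ys)" a] 0
        by (simp only: Nil append.simps gt_sum.simps(3)[of g] alt signed_sum_uminus)
    next
      case (Cons y zs)
      then show ?thesis
        using IH by (simp add: signed_sum_uminus)
    qed
  qed
  then show ?thesis
    using assms unfolding antisym_fun_def[of "Suc n"] by blast
qed

text \<open>The difference of the two functions does not depend on the first variable, so it may be
  evaluated where the first two variables coincide.\<close>

lemma antisym_fun_eqI:
  assumes "antisym_fun n f" "antisym_fun n g" "length (k # m) = n" "m \<noteq> []"
    and "\<And>k. f ((k + 1) # m) - f (k # m) = g ((k + 1) # m) - g (k # m)"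
  shows "f (k # m) = g (k # m)"
proof -
  obtain k2 ks where m: "m = k2 # ks" using assms(4) by (cases m) auto
  have "f (k # m) - g (k # m) = f (k2 # m) - g (k2 # m)"
  proof (rule signed_sum_induct[where a = k2 and b = k])
    fix b
    show "(f (b # m) - g (b # m) = f (k2 # m) - g (k2 # m)) = (f ((b + 1) # m) - g ((b + 1) # m) = f (k2 # m) - g (k2 # m))"
      using assms(5)[of b] by linarith
  qed simp
  moreover have "f (k2 # m) = 0" "g (k2 # m) = 0"
    using antisym_fun_head[OF assms(1), of ks k2 k2] antisym_fun_head[OF assms(2), of ks k2 k2] assms(3) m by auto
  ultimately show ?thesis by simp
qed

lemma esym_diff_fun: "(\<lambda>l. esym i f l - esym i g l) = esym i (\<lambda>l. f l - g l)"
  by (simp add: esym_diff fun_eq_iff)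

text \<open>Both sides are antisymmetric, so by \<open>antisym_fun_eqI\<close> it suffices to
  compare differences in the first variable. There \<open>gt_sum_head\<close> removes one summation,
  and the induction hypothesis applies to \<open>g\<close> with its first variable fixed.\<close>

lemma esym_gt_sum:
  "antisym_fun n g \<Longrightarrow> length ks = Suc n \<Longrightarrow> esym i (gt_sum g) ks = gt_sum (esym i g) ks"
proof (induction n arbitrary: g ks i)
  case 0
  then obtain k where "ks = [k]" by (cases ks) auto
  then show ?case by (cases i) (auto simp: esym_Nil)
next
  case (Suc n)
  obtain k m where ks: "ks = k # m" and m: "length m = Suc n"
    using Suc.prems(2) by (cases ks) auto
  have ne: "m \<noteq> []" using m by auto
  have a: "antisym_fun n (\<lambda>l. g (k # l))" for k
    using Suc.prems(1) antisym_fun_Cons by blast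
  have hd: "esym i (\<lambda>l. gt_sum g ((k + 1) # l) - gt_sum g (k # l)) m = - gt_sum (esym i (\<lambda>l. g (k # l))) m" for k i
  proof -
    have "esym i (\<lambda>l. gt_sum g ((k + 1) # l) - gt_sum g (k # l)) m = esym i (\<lambda>l. - gt_sum (\<lambda>r. g (k # r)) l) m"
      by (rule esym_cong, rule gt_sum_head) (use m in auto)
    then show ?thesis
      using Suc.IH[OF a m] by (simp add: esym_uminus)
  qed
  show ?case
    unfolding ks
  proof (rule antisym_fun_eqI)
    show "antisym_fun (Suc (Suc n)) (esym i (gt_sum g))" "antisym_fun (Suc (Suc n)) (gt_sum (esym i g))"
      using Suc.prems(1) esym_antisym_fun gt_sum_antisym_fun by blast+
    show "length (k # m) = Suc (Suc n)" "m \<noteq> []" using m by auto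
    fix k
    show "esym i (gt_sum g) ((k + 1) # m) - esym i (gt_sum g) (k # m) = gt_sum (esym i g) ((k + 1) # m) - gt_sum (esym i g) (k # m)"
    proof (cases i)
      case 0
      then show ?thesis by (simp add: esym_0_fun)
    next
      case (Suc j)
      have "esym i (gt_sum g) ((k + 1) # m) - esym i (gt_sum g) (k # m)
          = esym i (\<lambda>l. gt_sum g ((k + 1) # l) - gt_sum g (k # l)) m
          + esym j (\<lambda>l. gt_sum g ((k + 1 + 1) # l) - gt_sum g ((k + 1) # l)) m
          - esym j (\<lambda>l. gt_sum g ((k + 1) # l) - gt_sum g (k # l)) m"
        unfolding Suc esym.simps by (simp add: esym_diff)
      also have "\<dots> = - gt_sum (esym i (\<lambda>l. g (k # l))) m - (gt_sum (esym j (\<lambda>l. g ((k + 1) # l))) m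
          - gt_sum (esym j (\<lambda>l. g (k # l))) m)"
        unfolding hd by simp
      also have "\<dots> = - (gt_sum (esym i (\<lambda>l. g (k # l))) m + gt_sum (esym j (\<lambda>l. g ((k + 1) # l) - g (k # l))) m)"
        unfolding gt_sum_diff[symmetric] esym_diff_fun by simp
      also have "\<dots> = - gt_sum (\<lambda>l. esym i g (k # l)) m"
      proof -
        have "gt_sum (\<lambda>l. esym i g (k # l) - esym i (\<lambda>l. g (k # l)) l) m = gt_sum (esym j (\<lambda>l. g ((k + 1) # l) - g (k # l))) m"
          by (rule gt_sum_cong) (simp add: Suc)
        then show ?thesis by (simp add: gt_sum_diff)
      qed
      also have "\<dots> = gt_sum (esym i g) ((k + 1) # m) - gt_sum (esym i g) (k # m)"
        by (rule gt_sum_head[OF ne, symmetric])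
      finally show ?thesis .
    qed
  qed
qed

text \<open>The operator \<open>\<Prod>\<^bsub>p<q\<^esub> (1 + E\<^sub>p \<Delta>\<^sub>q)\<close>, one factor \<open>p\<close> at a time: the factor of the first variable is
  \<open>\<Sum>i. E\<^sub>1\<^sup>i e\<^sub>i(\<Delta>\<^sub>2, \<dots>, \<Delta>\<^sub>n)\<close>.\<close>

fun cross_op :: "(int list \<Rightarrow> int) \<Rightarrow> int list \<Rightarrow> int" where
  "cross_op f [] = f []"
| "cross_op f (k # ks) = cross_op (\<lambda>l. \<Sum>i\<le>length ks. esym i (\<lambda>m. f ((k + int i) # m)) l) ks"

lemma cross_op_cong:
  "(\<And>l. length l = length ks \<Longrightarrow> f l = g l) \<Longrightarrow> cross_op f ks = cross_op g ks"
proof (induction f ks arbitrary: g rule: cross_op.induct)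
  case (2 f k ks)
  show ?case
    unfolding cross_op.simps by (intro 2(1) sum.cong refl esym_cong 2(2)) simp
qed simp

lemma cross_op_add: "cross_op (\<lambda>l. f l + g l) ks = cross_op f ks + cross_op g ks"
proof (induction f ks arbitrary: g rule: cross_op.induct)
  case (2 f k ks)
  then show ?case by (simp add: esym_add sum.distrib)
qed simp

lemma cross_op_uminus: "cross_op (\<lambda>l. - f l) ks = - cross_op f ks"
  using cross_op_add[of f "\<lambda>l. - f l" ks] cross_op_add[of "\<lambda>_. 0" "\<lambda>_. 0" ks] by simp

lemma cross_op_diff: "cross_op (\<lambda>l. f l - g l) ks = cross_op f ks - cross_op g ks"
  using cross_op_add[of f "\<lambda>l. - g l" ks] by (simp add: cross_op_uminus)

text \<open>The factors that the first two variables contribute on the remaining ones. Their mutual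
  factor \<open>1 + E\<^sub>1 \<Delta>\<^sub>2\<close> is left out, which makes the expression
  antisymmetric in \<open>a\<close> and \<open>b\<close> for antisymmetric \<open>f\<close>.\<close>

definition cross_pair :: "(int list \<Rightarrow> int) \<Rightarrow> int \<Rightarrow> int \<Rightarrow> int list \<Rightarrow> int" where
  "cross_pair f a b l = (\<Sum>j\<le>length l. \<Sum>i\<le>length l. esym j (esym i (\<lambda>m. f ((a + int i) # (b + int j) # m))) l)"

lemma cross_pair_swap:
  assumes "antisym_fun (length l + 2) f"
  shows "cross_pair f a b l = - cross_pair f b a l"
proof -
  have "esym j (esym i (\<lambda>m. f ((a + int i) # (b + int j) # m))) l
      = - esym i (esym j (\<lambda>m. f ((b + int j) # (a + int i) # m))) l" for i j
  proof -
    have "esym j (esym i (\<lambda>m. f ((a + int i) # (b + int j) # m))) l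
      = esym j (esym i (\<lambda>m. - f ((b + int j) # (a + int i) # m))) l"
      by (intro esym_cong antisym_fun_head[OF assms]) simp
    also have "\<dots> = - esym j (esym i (\<lambda>m. f ((b + int j) # (a + int i) # m))) l"
      by (simp add: esym_uminus[abs_def] esym_uminus)
    finally show ?thesis by (simp add: esym_commute)
  qed
  then have "cross_pair f a b l = - (\<Sum>j\<le>length l. \<Sum>i\<le>length l. esym i (esym j (\<lambda>m. f ((b + int j) # (a + int i) # m))) l)"
    unfolding cross_pair_def by (simp add: sum_negf)
  then show ?thesis
    unfolding cross_pair_def by (subst sum.swap) simp
qed

text \<open>The three terms come from the mutual factor of the first two variables, \<open>1 +
  E\<^sub>1 \<Delta>\<^sub>2 = 1 + E\<^sub>1 E\<^sub>2 - E\<^sub>1\<close>.\<close>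

lemma cross_op_Cons2:
  "cross_op f (a # b # r) = cross_op (\<lambda>l. cross_pair f a b l + cross_pair f (a + 1) (b + 1) l - cross_pair f (a + 1) b l) r"
proof -
  define N where "N = length r"
  have *: "(\<Sum>i\<le>Suc N. esym i (\<lambda>m. f ((a + int i) # m)) (b # q))
    = (\<Sum>i\<le>N. esym i (\<lambda>m. f ((a + int i) # b # m)) q)
      + (\<Sum>i\<le>N. esym i (\<lambda>m. f ((a + 1 + int i) # (b + 1) # m)) q)
      - (\<Sum>i\<le>N. esym i (\<lambda>m. f ((a + 1 + int i) # b # m)) q)" if "length q = N" for b q
  proof -
    have "(\<Sum>i\<le>Suc N. esym i (\<lambda>m. f ((a + int i) # m)) (b # q))
      = esym 0 (\<lambda>m. f (a # b # m)) q + (\<Sum>i\<le>N. esym (Suc i) (\<lambda>m. f ((a + int (Suc i)) # b # m)) q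
         + esym i (\<lambda>m. f ((a + int (Suc i)) # (b + 1) # m) - f ((a + int (Suc i)) # b # m)) q)"
      by (subst sum.atMost_Suc_shift) simp
    also have "\<dots> = (\<Sum>i\<le>Suc N. esym i (\<lambda>m. f ((a + int i) # b # m)) q) +
        (\<Sum>i\<le>N. esym i (\<lambda>m. f ((a + 1 + int i) # (b + 1) # m) - f ((a + 1 + int i) # b # m)) q)"
      by (subst sum.atMost_Suc_shift) (simp add: sum.distrib add.assoc)
    \<comment> \<open>The top term is an elementary symmetric polynomial of degree
      \<open>N + 1\<close> in \<open>N\<close> variables, hence zero.\<close>
    also have "(\<Sum>i\<le>Suc N. esym i (\<lambda>m. f ((a + int i) # b # m)) q) = (\<Sum>i\<le>N. esym i (\<lambda>m. f ((a + int i) # b # m)) q)"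
      using that by (simp add: esym_gt)
    finally show ?thesis by (simp add: esym_diff sum_subtractf)
  qed
  have "cross_op f (a # b # r) = cross_op (\<lambda>l. \<Sum>j\<le>N. esym j (\<lambda>q. \<Sum>i\<le>Suc N. esym i (\<lambda>m. f ((a + int i) # m)) ((b + int j) # q)) l) r"
    by (simp only: cross_op.simps N_def list.size Nat.add_0_right add_Suc_right)
  also have "\<dots> = cross_op (\<lambda>l. cross_pair f a b l + cross_pair f (a + 1) (b + 1) l - cross_pair f (a + 1) b l) r"
  proof (rule cross_op_cong)
    fix l :: "int list"
    assume l: "length l = length r"
    have "(\<Sum>j\<le>N. esym j (\<lambda>q. \<Sum>i\<le>Suc N. esym i (\<lambda>m. f ((a + int i) # m)) ((b + int j) # q)) l)
      = (\<Sum>j\<le>N. esym j (\<lambda>q. (\<Sum>i\<le>N. esym i (\<lambda>m. f ((a + int i) # (b + int j) # m)) q)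
      + (\<Sum>i\<le>N. esym i (\<lambda>m. f ((a + 1 + int i) # (b + 1 + int j) # m)) q)
      - (\<Sum>i\<le>N. esym i (\<lambda>m. f ((a + 1 + int i) # (b + int j) # m)) q)) l)"
      by (intro sum.cong refl esym_cong, subst *) (simp_all add: l N_def add.assoc add.commute add.left_commute)
    also have "\<dots> = cross_pair f a b l + cross_pair f (a + 1) (b + 1) l - cross_pair f (a + 1) b l"
      unfolding cross_pair_def l N_def[symmetric]
      by (simp add: esym_diff esym_add esym_sum sum.distrib sum_subtractf)
    finally show "(\<Sum>j\<le>N. esym j (\<lambda>q. \<Sum>i\<le>Suc N. esym i (\<lambda>m. f ((a + int i) # m)) ((b + int j) # q)) l) = \<dots>" .
  qed
  finally show ?thesis .
qed

text \<open>The left-hand side minus the right-hand side is \<open>1 + E\<^sub>2 \<Delta>\<^sub>1\<close> applied to \<open>cross_op f\<close>, which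
  makes the whole operator symmetric in the first two variables, and it is applied to an antisymmetric function.\<close>

lemma cross_op_bracket:
  assumes "antisym_fun (length r + 2) f"
  shows "cross_op f (a # a # r) + cross_op f ((a + 1) # (a + 1) # r) = cross_op f (a # (a + 1) # r)"
  unfolding cross_op_Cons2 cross_op_add[symmetric]
proof (rule cross_op_cong)
  fix l :: "int list"
  assume l: "length l = length r"
  have sw: "cross_pair f x y l = - cross_pair f y x l" for x y
    by (rule cross_pair_swap) (use assms l in simp)
  show "cross_pair f a a l + cross_pair f (a + 1) (a + 1) l - cross_pair f (a + 1) a l
      + (cross_pair f (a + 1) (a + 1) l + cross_pair f (a + 1 + 1) (a + 1 + 1) l - cross_pair f (a + 1 + 1) (a + 1) l)
      = cross_pair f a (a + 1) l + cross_pair f (a + 1) (a + 1 + 1) l - cross_pair f (a + 1) (a + 1) l"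
    using sw[of a a] sw[of "a + 1" "a + 1"] sw[of "a + 1 + 1" "a + 1 + 1"] sw[of "a + 1" a] sw[of "a + 1 + 1" "a + 1"]
    by linarith
qed

text \<open>For strictly increasing \<open>ks\<close> this sums over the strictly increasing lists that interlace with
  \<open>ks\<close>; signed sums extend it to all integer lists. Writing the case \<open>l\<^sub>1 = k\<^sub>2\<close> separately enforces
  \<open>l\<^sub>1 < l\<^sub>2\<close>.\<close>

fun seqsum :: "(int list \<Rightarrow> int) \<Rightarrow> int list \<Rightarrow> int" where
  "seqsum A [] = 0"
| "seqsum A [k] = A []"
| "seqsum A (k1 # k2 # ks) = signed_sum k1 k2 (\<lambda>l. seqsum (\<lambda>m. A (l # m)) (k2 # ks))
    + seqsum (\<lambda>m. A (k2 # m)) ((k2 + 1) # ks)"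

lemma seqsum_cong:
  "(\<And>l. Suc (length l) = length ks \<Longrightarrow> f l = g l) \<Longrightarrow> seqsum f ks = seqsum g ks"
proof (induction f ks arbitrary: g rule: seqsum.induct)
  case (3 f k1 k2 ks)
  show ?case
    unfolding seqsum.simps by (intro arg_cong2[where f = "(+)"] signed_sum_cong 3) (use 3(3) in simp_all)
qed simp_all

text \<open>Moving each \<open>esym i\<close> past \<open>gt_sum\<close> and applying
  \<open>gt_sum_head\<close> turns fixing the first variable of \<open>g\<close> at \<open>l\<close>
  into a negative first difference of \<open>cross_op (gt_sum g)\<close>, ready to telescope in
  \<open>l\<close>.\<close>

lemma seqsum_cross_op_step:
  assumes "antisym_fun (Suc n) g" "length m = Suc n"
  shows "cross_op (gt_sum (\<lambda>m. \<Sum>i\<le>n. esym i (\<lambda>r. g ((l + int i) # r)) m)) m = cross_op (gt_sum g) (l # m) - cross_op (gt_sum g) ((l + 1) # m)"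
proof -
  have a: "antisym_fun n (\<lambda>l. g (k # l))" for k
    using assms(1) antisym_fun_Cons by blast
  have "gt_sum (\<lambda>m. \<Sum>i\<le>n. esym i (\<lambda>r. g ((l + int i) # r)) m) q
      = (\<Sum>i\<le>length m. esym i (\<lambda>r. gt_sum g ((l + int i) # r)) q) - (\<Sum>i\<le>length m. esym i (\<lambda>r. gt_sum g ((l + 1 + int i) # r)) q)"
    if q: "length q = length m" for q
  proof -
    have 0: "gt_sum (esym (Suc n) (\<lambda>r. g ((l + int (Suc n)) # r))) q = 0"
    proof -
      have "gt_sum (esym (Suc n) (\<lambda>r. g ((l + int (Suc n)) # r))) q = gt_sum (\<lambda>r. 0) q"
        by (rule gt_sum_cong, rule esym_gt) (use q assms in simp)
      then show ?thesis using gt_sum_sum[of "{}" "\<lambda>_ _. 0" q] by simp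
    qed
    have "gt_sum (\<lambda>m. \<Sum>i\<le>n. esym i (\<lambda>r. g ((l + int i) # r)) m) q = (\<Sum>i\<le>Suc n. gt_sum (esym i (\<lambda>r. g ((l + int i) # r))) q)"
      using 0 by (simp add: gt_sum_sum)
    also have "\<dots> = (\<Sum>i\<le>length m. esym i (gt_sum (\<lambda>r. g ((l + int i) # r))) q)"
      using esym_gt_sum[OF a] q assms(2) by simp
    also have "\<dots> = (\<Sum>i\<le>length m. esym i (\<lambda>r. gt_sum g ((l + int i) # r) - gt_sum g ((l + 1 + int i) # r)) q)"
    proof (intro sum.cong refl esym_cong)
      fix i and r :: "int list" assume "length r = length q"
      then have "r \<noteq> []" using q assms(2) by auto
      from gt_sum_head[OF this, of g "l + int i"]
      show "gt_sum (\<lambda>r. g ((l + int i) # r)) r = gt_sum g ((l + int i) # r) - gt_sum g ((l + 1 + int i) # r)"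
        by (simp add: algebra_simps)
    qed
    finally show ?thesis by (simp add: esym_diff sum_subtractf)
  qed
  then have "cross_op (gt_sum (\<lambda>m. \<Sum>i\<le>n. esym i (\<lambda>r. g ((l + int i) # r)) m)) m
    = cross_op (\<lambda>q. (\<Sum>i\<le>length m. esym i (\<lambda>r. gt_sum g ((l + int i) # r)) q) - (\<Sum>i\<le>length m. esym i (\<lambda>r. gt_sum g ((l + 1 + int i) # r)) q)) m"
    by (rule cross_op_cong)
  then show ?thesis by (simp add: cross_op_diff)
qed

text \<open>\<open>cross_op\<close> intertwines Gelfand-Tsetlin summation with summation over
  interlacing strictly increasing lists. The range from \<open>k1\<close> to \<open>k2\<close>
  telescopes by \<open>seqsum_cross_op_step\<close>, and the boundary terms at \<open>k2\<close>
  cancel by \<open>cross_op_bracket\<close>.\<close>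

lemma seqsum_cross_op:
  "antisym_fun n g \<Longrightarrow> length ks = Suc n \<Longrightarrow> seqsum (cross_op g) ks = cross_op (gt_sum g) ks"
proof (induction n arbitrary: g ks)
  case 0
  then obtain k where "ks = [k]" by (cases ks) auto
  then show ?case by simp
next
  case (Suc n)
  obtain k1 k2 r where ks: "ks = k1 # k2 # r" and r: "length r = n"
    using Suc.prems(2) by (metis length_Suc_conv)
  have a: "antisym_fun n (\<lambda>l. g (k # l))" for k
    using Suc.prems(1) antisym_fun_Cons by blast
  have *: "seqsum (\<lambda>m. cross_op g (l # m)) (b # r) = cross_op (gt_sum g) (l # b # r) - cross_op (gt_sum g) ((l + 1) # b # r)" for l b
  proof -
    have "seqsum (\<lambda>m. cross_op g (l # m)) (b # r) = seqsum (cross_op (\<lambda>m. \<Sum>i\<le>n. esym i (\<lambda>r. g ((l + int i) # r)) m)) (b # r)"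
      by (rule seqsum_cong) (use r in simp)
    also have "\<dots> = cross_op (gt_sum (\<lambda>m. \<Sum>i\<le>n. esym i (\<lambda>r. g ((l + int i) # r)) m)) (b # r)"
      by (intro Suc.IH antisym_fun_sum esym_antisym_fun a) (use r in simp)
    also have "\<dots> = cross_op (gt_sum g) (l # b # r) - cross_op (gt_sum g) ((l + 1) # b # r)"
      by (rule seqsum_cross_op_step) (use r Suc.prems(1) in simp_all)
    finally show ?thesis .
  qed
  have "antisym_fun (length r + 2) (gt_sum g)"
    using gt_sum_antisym_fun[OF Suc.prems(1)] r by simp
  from cross_op_bracket[OF this, of k2] show ?case
    unfolding ks seqsum.simps *
    using signed_sum_telescope[of k1 k2 "\<lambda>l. cross_op (gt_sum g) (l # k2 # r)"] by simp
qed

lemma seqsum_diff: "seqsum (\<lambda>l. f l - g l) ks = seqsum f ks - seqsum g ks"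
proof (induction f ks arbitrary: g rule: seqsum.induct)
  case (3 f k1 k2 ks)
  show ?case
    unfolding seqsum.simps 3 signed_sum_diff by simp
qed simp_all

lemma seqsum_zero: "seqsum (\<lambda>l. 0) ks = 0"
  using seqsum_diff[of "\<lambda>_. 0" "\<lambda>_. 0" ks] by simp

text \<open>The last argument only bounds the last summation index from above; raising it to
  \<open>c + 1\<close> adds the lists that end in \<open>c + 1\<close>.\<close>

lemma seqsum_snoc:
  "seqsum A (ks @ [c + 1]) - seqsum A (ks @ [c]) = seqsum (\<lambda>m. A (m @ [c + 1])) ks"
proof (induction A ks rule: seqsum.induct)
  case (2 A k)
  then show ?case by (simp add: signed_sum_Suc)
next
  case (3 A k1 k2 ks)
  have "signed_sum k1 k2 (\<lambda>l. seqsum (\<lambda>m. A (l # m)) (k2 # ks @ [c + 1])) - signed_sum k1 k2 (\<lambda>l. seqsum (\<lambda>m. A (l # m)) (k2 # ks @ [c]))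
    = signed_sum k1 k2 (\<lambda>l. seqsum (\<lambda>m. A (l # m @ [c + 1])) (k2 # ks))"
    unfolding signed_sum_diff[symmetric] by (intro signed_sum_cong) (use 3(1) in simp)
  then show ?case
    using 3(2) by simp
qed simp

text \<open>On lists of length \<open>n\<close> this is the product of
  \<open>(k\<^sub>q - k\<^sub>p) / (q - p)\<close> over all \<open>p < q\<close>, the number of
  Gelfand-Tsetlin patterns in shifted coordinates.\<close>

fun gt_iter :: "nat \<Rightarrow> int list \<Rightarrow> int" where
  "gt_iter 0 = (\<lambda>_. 1)"
| "gt_iter (Suc n) = gt_sum (gt_iter n)"

lemma gt_iter_antisym_fun: "antisym_fun n (gt_iter n)"
  by (induction n) (simp add: antisym_fun_def, simp add: gt_sum_antisym_fun)

text \<open>The operator commutes with every summation and so passes down to the constant at the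
  empty list, where it is zero.\<close>

lemma esym_gt_iter: "length ks = n \<Longrightarrow> esym (Suc i) (gt_iter n) ks = 0"
proof (induction n arbitrary: ks)
  case (Suc n)
  have "esym (Suc i) (gt_iter (Suc n)) ks = gt_sum (esym (Suc i) (gt_iter n)) ks"
    using esym_gt_sum[OF gt_iter_antisym_fun Suc.prems] by simp
  also have "\<dots> = gt_sum (\<lambda>_. 0) ks"
    by (rule gt_sum_cong) (use Suc in simp)
  finally show ?case
    using gt_sum_sum[of "{}" "\<lambda>_ _. 0" ks] by simp
qed simp

text \<open>For increasing arguments this is the number \<open>\<alpha>(n; k)\<close> of monotone triangles with bottom row \<open>k\<close>.\<close>

definition mt :: "nat \<Rightarrow> int list \<Rightarrow> int" where
  "mt n = cross_op (gt_iter n)"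

lemma mt_0 [simp]: "mt 0 [] = 1"
  by (simp add: mt_def)

lemma mt_Suc: "length ks = Suc n \<Longrightarrow> mt (Suc n) ks = seqsum (mt n) ks"
  unfolding mt_def using seqsum_cross_op[OF gt_iter_antisym_fun, of ks n] by simp

section \<open>Finite differences in one variable\<close>

definition fdiff :: "(int \<Rightarrow> int) \<Rightarrow> int \<Rightarrow> int" where
  "fdiff f x = f (x + 1) - f x"

abbreviation fdiffs :: "nat \<Rightarrow> (int \<Rightarrow> int) \<Rightarrow> int \<Rightarrow> int" where
  "fdiffs i \<equiv> fdiff ^^ i"

lemma fdiffs_Suc: "fdiffs (Suc i) f x = fdiffs i f (x + 1) - fdiffs i f x"
  by (simp add: fdiff_def)

lemma fdiffs_Suc': "fdiffs (Suc i) f = fdiffs i (fdiff f)"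
  by (simp add: funpow_swap1)

lemma fdiffs_diff: "fdiffs i (\<lambda>x. f x - g x) x = fdiffs i f x - fdiffs i g x"
  by (induction i arbitrary: x) (simp_all add: fdiff_def)

lemma fdiffs_shift: "fdiffs i (\<lambda>x. f (x + c)) x = fdiffs i f (x + c)"
  by (induction i arbitrary: x) (simp_all add: fdiff_def algebra_simps)

lemma fdiffs_cmult: "fdiffs i (\<lambda>x. c * f x) x = c * fdiffs i f x"
  by (induction i arbitrary: x) (simp_all add: fdiff_def algebra_simps)

lemma fdiffs_sum: "fdiffs i (\<lambda>x. \<Sum>j\<in>I. f j x) x = (\<Sum>j\<in>I. fdiffs i (f j) x)"
  by (induction i arbitrary: x) (simp_all add: fdiff_def sum_subtractf)

lemma fdiffs_fdiffs: "fdiffs i (fdiffs j f) x = fdiffs (i + j) f x"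
  by (simp add: funpow_add)

lemma fdiffs_zero_mono:
  assumes "\<And>x. fdiffs n f x = 0"
  shows "fdiffs (i + n) f x = 0"
  by (induction i arbitrary: x) (simp_all add: fdiff_def assms)

lemma alternating_telescope:
  "(\<Sum>i<n. (-1) ^ i * (a i + a (Suc i))) = (a 0 - (-1) ^ n * a n :: int)"
  by (induction n) (simp_all add: algebra_simps)

text \<open>Both sides are \<open>(1 + E \<Delta>)\<^sup>-\<^sup>1 p\<close>, because \<open>1 + E \<Delta> = E + \<Delta>\<^sup>2\<close>.\<close>

lemma geometric_identity:
  assumes "\<And>x. fdiffs n p x = 0"
  shows "(\<Sum>i<n. (-1) ^ i * fdiffs i p (k + int i)) = (\<Sum>i<n. (-1) ^ i * fdiffs (2 * i) p (k - 1 - int i))"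
proof -
  define U where "U k = (\<Sum>i<n. (-1) ^ i * fdiffs i p (k + int i))" for k
  define V where "V k = (\<Sum>i<n. (-1) ^ i * fdiffs (2 * i) p (k - 1 - int i))" for k
  define Z where "Z k = U k - V k" for k
  have U: "U k + fdiff U (k + 1) = p k" for k
  proof -
    have "fdiff U (k + 1) = (\<Sum>i<n. (-1) ^ i * fdiffs (Suc i) p (k + int (Suc i)))"
      unfolding fdiff_def U_def fdiffs_Suc sum_subtractf[symmetric]
      by (intro sum.cong refl) (simp add: algebra_simps)
    then have "U k + fdiff U (k + 1) = (\<Sum>i<n. (-1) ^ i * (fdiffs i p (k + int i) + fdiffs (Suc i) p (k + int (Suc i))))"
      unfolding U_def by (simp only: sum.distrib[symmetric] ring_distribs)
    then show ?thesis
      using alternating_telescope[of "\<lambda>i. fdiffs i p (k + int i)" n] assms by simp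
  qed
  have V: "V k + fdiff V (k + 1) = p k" for k
  proof -
    \<comment> \<open>\<open>1 + E \<Delta>\<close> is used in the form
      \<open>E + \<Delta>\<^sup>2\<close>, for which the series of \<open>V\<close>
      telescopes.\<close>
    have "V k + fdiff V (k + 1) = V (k + 1) + (V (k + 2) - 2 * V (k + 1) + V k)"
      by (simp add: fdiff_def add.commute)
    also have "V (k + 2) - 2 * V (k + 1) + V k = (\<Sum>i<n. (-1) ^ i * fdiffs (2 * Suc i) p (k - int (Suc i)))"
    proof -
      have "V (k + 2) - 2 * V (k + 1) + V k = (\<Sum>i<n. (-1) ^ i * fdiffs (2 * i) p (k + 2 - 1 - int i)
         - 2 * ((-1) ^ i * fdiffs (2 * i) p (k + 1 - 1 - int i)) + (-1) ^ i * fdiffs (2 * i) p (k - 1 - int i))"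
        unfolding V_def by (simp only: sum.distrib sum_subtractf sum_distrib_left)
      also have "\<dots> = (\<Sum>i<n. (-1) ^ i * fdiffs (2 * Suc i) p (k - int (Suc i)))"
      proof (intro sum.cong refl)
        fix i
        have "2 * Suc i = Suc (Suc (2 * i))" by simp
        then have "fdiffs (2 * Suc i) p (k - int (Suc i)) = fdiffs (2 * i) p (k - int (Suc i) + 1 + 1)
            - fdiffs (2 * i) p (k - int (Suc i) + 1) - (fdiffs (2 * i) p (k - int (Suc i) + 1) - fdiffs (2 * i) p (k - int (Suc i)))"
          by (simp only: fdiffs_Suc)
        moreover have "k + 2 - 1 - int i = k - int (Suc i) + 1 + 1" "k + 1 - 1 - int i = k - int (Suc i) + 1"
          "k - 1 - int i = k - int (Suc i)" by simp_all
        ultimately show "(-1) ^ i * fdiffs (2 * i) p (k + 2 - 1 - int i)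
         - 2 * ((-1) ^ i * fdiffs (2 * i) p (k + 1 - 1 - int i)) + (-1) ^ i * fdiffs (2 * i) p (k - 1 - int i)
         = (-1) ^ i * fdiffs (2 * Suc i) p (k - int (Suc i))"
          by (simp only: ring_distribs; simp)
      qed
      finally show ?thesis .
    qed
    also have "V (k + 1) + \<dots> = (\<Sum>i<n. (-1) ^ i * (fdiffs (2 * i) p (k - int i) + fdiffs (2 * Suc i) p (k - int (Suc i))))"
      unfolding V_def by (simp add: sum.distrib ring_distribs)
    also have "\<dots> = fdiffs (2 * 0) p (k - int 0) - (-1) ^ n * fdiffs (2 * n) p (k - int n)"
      by (rule alternating_telescope)
    also have "\<dots> = p k"
      using fdiffs_zero_mono[of n p n, OF assms] by (simp add: mult_2)
    finally show ?thesis .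
  qed
  \<comment> \<open>The difference of the two solutions is fixed by \<open>- E \<Delta>\<close>.
    Iterating this \<open>n\<close> times produces an \<open>n\<close>-th difference, which vanishes
    because it does for \<open>p\<close>.\<close>
  have Z: "Z k = - fdiff Z (k + 1)" for k
    using U[of k] V[of k] unfolding Z_def fdiff_def by linarith
  have Zi: "fdiffs i Z k = - fdiffs (Suc i) Z (k + 1)" for i k
  proof (induction i arbitrary: k)
    case 0
    then show ?case using Z[of k] by simp
  next
    case (Suc i)
    show ?case
      unfolding fdiffs_Suc[of "Suc i"] fdiffs_Suc[of i Z k] Suc[of "k + 1"] Suc[of k] by simp
  qed
  have "Z k = (-1) ^ i * fdiffs i Z (k + int i)" for i
  proof (induction i)
    case (Suc i)
    then show ?case using Zi[of i "k + int i"] by (simp add: algebra_simps)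
  qed simp
  moreover have "fdiffs n Z x = 0" for x
  proof -
    have z: "fdiffs (n + i) p x = 0" for i x
      using fdiffs_zero_mono[of n p i x] assms by (simp only: add.commute)
    have "fdiffs n U x = 0"
      unfolding U_def fdiffs_sum fdiffs_cmult fdiffs_shift fdiffs_fdiffs
      by (simp add: z)
    moreover have "fdiffs n V x = 0"
    proof -
      have V: "V = (\<lambda>k. \<Sum>i<n. (-1) ^ i * fdiffs (2 * i) p (k + (- 1 - int i)))"
        unfolding V_def by (simp add: algebra_simps)
      show ?thesis
        unfolding V fdiffs_sum fdiffs_cmult fdiffs_shift fdiffs_fdiffs
        by (simp add: z)
    qed
    ultimately show ?thesis
      unfolding Z_def fdiffs_diff by simp
  qed
  ultimately have "Z k = (-1) ^ n * 0" by metis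
  then show ?thesis by (simp add: Z_def U_def V_def)
qed

text \<open>The binomial series of \<open>E\<^sup>-\<^sup>N = (1 + \<Delta>)\<^sup>-\<^sup>N\<close>. For \<open>N = 0\<close> the truncated \<open>N + t - 1\<close> is harmless.\<close>

lemma newton_backward:
  assumes "\<And>x. fdiffs m f x = 0"
  shows "f x = (\<Sum>t<m. (-1) ^ t * int ((N + t - 1) choose t) * fdiffs t f (x + int N))"
  using assms
proof (induction m arbitrary: f x N)
  case 0
  then show ?case by simp
next
  case (Suc m)
  note IH = Suc.IH and prems = Suc.prems
  show ?case
  proof (induction N arbitrary: x)
    case 0
    show ?case
      by (subst sum.lessThan_Suc_shift) (simp add: binomial_eq_0)
  next
    case (Suc N)
    have z: "fdiffs m (fdiff f) x = 0" for x
      using prems unfolding fdiffs_Suc' by blast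
    have c: "x + 1 + int N = x + int (Suc N)" by simp
    \<comment> \<open>The first term is covered by the induction on \<open>N\<close>, the second by
      the one on \<open>m\<close>; Pascal's rule then merges the coefficients.\<close>
    have "f x = f (x + 1) - fdiff f x"
      by (simp add: fdiff_def)
    also have "f (x + 1) = (\<Sum>t<Suc m. (-1) ^ t * int ((N + t - 1) choose t) * fdiffs t f (x + int (Suc N)))"
      using Suc.IH[of "x + 1"] unfolding c .
    also have "\<dots> = f (x + int (Suc N)) +
        (\<Sum>t<m. (-1) ^ Suc t * int ((N + t) choose Suc t) * fdiffs (Suc t) f (x + int (Suc N)))"
      by (subst sum.lessThan_Suc_shift) simp
    also have "fdiff f x = (\<Sum>t<m. (-1) ^ t * int ((Suc N + t - 1) choose t) * fdiffs t (fdiff f) (x + int (Suc N)))"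
      by (rule IH) (rule z)
    finally have "f x = f (x + int (Suc N)) +
        (\<Sum>t<m. (-1) ^ Suc t * int ((N + t) choose Suc t) * fdiffs (Suc t) f (x + int (Suc N))
           - (-1) ^ t * int ((N + t) choose t) * fdiffs (Suc t) f (x + int (Suc N)))"
      unfolding fdiffs_Suc'[symmetric] sum_subtractf by simp
    also have "\<dots> = f (x + int (Suc N)) +
        (\<Sum>t<m. (-1) ^ Suc t * int ((Suc N + Suc t - 1) choose Suc t) * fdiffs (Suc t) f (x + int (Suc N)))"
      by (intro arg_cong2[where f = "(+)"] sum.cong refl) (simp add: algebra_simps del: funpow.simps)
    also have "\<dots> = (\<Sum>t<Suc m. (-1) ^ t * int ((Suc N + t - 1) choose t) * fdiffs t f (x + int (Suc N)))"
      by (subst sum.lessThan_Suc_shift[of _ m]) simp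
    finally show ?case .
  qed
qed

section \<open>The last argument of the monotone triangle count\<close>

lemma fdiffs_seqsum: "fdiffs i (\<lambda>x. seqsum (A x) ks) x = seqsum (\<lambda>m. fdiffs i (\<lambda>x. A x m) x) ks"
  by (induction i arbitrary: x) (simp_all add: fdiff_def seqsum_diff)

text \<open>By \<open>seqsum_snoc\<close>, a difference in the last variable strips the bottom row
  and leaves \<open>x + 1\<close> as the last entry of the row above.\<close>

lemma fdiffs_mt_snoc:
  assumes "length ks = n"
  shows "fdiffs (Suc i) (\<lambda>x. mt (Suc n) (ks @ [x])) c = seqsum (\<lambda>m. fdiffs i (\<lambda>x. mt n (m @ [x])) (c + 1)) ks"
proof -
  have "fdiff (\<lambda>x. mt (Suc n) (ks @ [x])) = (\<lambda>x. seqsum (\<lambda>m. mt n (m @ [x + 1])) ks)"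
    using assms by (simp add: fdiff_def fun_eq_iff mt_Suc seqsum_snoc)
  then show ?thesis
    unfolding fdiffs_Suc' using fdiffs_shift[of i "\<lambda>x. mt n (m @ [x])" 1 c for m] by (simp add: fdiffs_seqsum)
qed

text \<open>Each difference strips a row until an empty sum remains; so \<open>mt n\<close> has
  degree less than \<open>n\<close> in its last argument.\<close>

lemma fdiffs_mt_zero:
  "Suc (length ks) = n \<Longrightarrow> fdiffs n (\<lambda>x. mt n (ks @ [x])) c = 0"
proof (induction n arbitrary: ks c)
  case (Suc n)
  have "fdiffs (Suc n) (\<lambda>x. mt (Suc n) (ks @ [x])) c = seqsum (\<lambda>m. fdiffs n (\<lambda>x. mt n (m @ [x])) (c + 1)) ks"
    by (rule fdiffs_mt_snoc) (use Suc.prems in simp)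
  also have "\<dots> = seqsum (\<lambda>_. 0) ks"
    by (rule seqsum_cong, rule Suc.IH) (use Suc.prems in simp)
  finally show ?case by (simp only: seqsum_zero)
qed simp

text \<open>The factor \<open>\<Prod>\<^bsub>p\<^esub> (1 + E\<^sub>p \<Delta>\<^sub>z)\<close> that the last variable \<open>z\<close> contributes to \<open>cross_op\<close>.\<close>

fun last_op :: "(int list \<Rightarrow> int) \<Rightarrow> int list \<Rightarrow> int \<Rightarrow> int" where
  "last_op f [] z = f [z]"
| "last_op f (k # l) z = last_op (\<lambda>m. f (k # m)) l z + last_op (\<lambda>m. f ((k + 1) # m)) l (z + 1) - last_op (\<lambda>m. f ((k + 1) # m)) l z"

lemma last_op_diff: "last_op (\<lambda>l. f l - g l) ks z = last_op f ks z - last_op g ks z"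
  by (induction ks arbitrary: f g z) simp_all

lemma last_op_add: "last_op (\<lambda>l. f l + g l) ks z = last_op f ks z + last_op g ks z"
  by (induction ks arbitrary: f g z) simp_all

lemma last_op_zero: "last_op (\<lambda>l. 0) ks z = 0"
  using last_op_diff[of "\<lambda>_. 0" "\<lambda>_. 0" ks z] by simp

lemma last_op_sum: "finite I \<Longrightarrow> last_op (\<lambda>l. \<Sum>j\<in>I. f j l) ks z = (\<Sum>j\<in>I. last_op (f j) ks z)"
  by (induction I rule: finite_induct) (simp_all add: last_op_zero last_op_add)

text \<open>Differences commute with \<open>last_op\<close>. The two terms expand the elementary
  symmetric polynomial in the variables of \<open>l\<close> and \<open>z\<close> along the
  difference in \<open>z\<close>.\<close>

lemma last_op_esym: "last_op (esym (Suc i) f) l z = esym (Suc i) (\<lambda>q. last_op f q z) l + esym i (\<lambda>q. last_op f q (z + 1) - last_op f q z) l"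
proof (induction l arbitrary: f i z)
  case Nil
  then show ?case by (cases i) simp_all
next
  case (Cons k l)
  show ?case
  proof (cases i)
    case 0
    then show ?thesis
      by (simp only: last_op.simps esym.simps last_op_add last_op_diff esym_add esym_diff esym_diff[abs_def] Cons.IH esym_0_fun; simp)
  next
    case (Suc j)
    then show ?thesis
      by (simp only: last_op.simps esym.simps last_op_add last_op_diff esym_add esym_diff esym_diff[abs_def] Cons.IH; simp)
  qed
qed

text \<open>The factors of \<open>cross_op\<close> commute, so the product may be split at its last
  variable instead of its first.\<close>

lemma cross_op_snoc: "cross_op f (ks @ [z]) = cross_op (\<lambda>l. last_op f l z) ks"
proof (induction ks arbitrary: f)
  case (Cons k ks)
  define m where "m = length ks"
  define f' where "f' j = (\<lambda>q. f ((k + int j) # q))" for j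
  have "cross_op f ((k # ks) @ [z]) = cross_op (\<lambda>l. last_op (\<lambda>l. \<Sum>i\<le>Suc m. esym i (f' i) l) l z) ks"
    by (simp add: Cons.IH m_def f'_def)
  also have "\<dots> = cross_op (\<lambda>l. \<Sum>i\<le>m. esym i (\<lambda>q. last_op f ((k + int i) # q) z) l) ks"
  proof (rule cross_op_cong)
    fix l :: "int list" assume l: "length l = length ks"
    have "last_op (\<lambda>l. \<Sum>i\<le>Suc m. esym i (f' i) l) l z
      = last_op (f' 0) l z + (\<Sum>i\<le>m. last_op (esym (Suc i) (f' (Suc i))) l z)"
      unfolding last_op_sum[OF finite_atMost] by (subst sum.atMost_Suc_shift) (simp only: esym_0_fun)
    also have "\<dots> = (\<Sum>i\<le>Suc m. esym i (\<lambda>q. last_op (f' i) q z) l)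
        + (\<Sum>i\<le>m. esym i (\<lambda>q. last_op (f' (Suc i)) q (z + 1) - last_op (f' (Suc i)) q z) l)"
      by (subst sum.atMost_Suc_shift) (simp add: last_op_esym sum.distrib)
    also have "(\<Sum>i\<le>Suc m. esym i (\<lambda>q. last_op (f' i) q z) l) = (\<Sum>i\<le>m. esym i (\<lambda>q. last_op (f' i) q z) l)"
      using l by (simp add: esym_gt m_def)
    also have "\<dots> + (\<Sum>i\<le>m. esym i (\<lambda>q. last_op (f' (Suc i)) q (z + 1) - last_op (f' (Suc i)) q z) l)
      = (\<Sum>i\<le>m. esym i (\<lambda>q. last_op f ((k + int i) # q) z) l)"
      by (simp add: f'_def sum.distrib[symmetric] esym_add esym_diff algebra_simps)
    finally show "last_op (\<lambda>l. \<Sum>i\<le>Suc m. esym i (f' i) l) l z = (\<Sum>i\<le>m. esym i (\<lambda>q. last_op f ((k + int i) # q) z) l)" .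
  qed
  finally show ?case by (simp add: m_def)
qed simp

text \<open>Each factor is \<open>1 + E\<^sub>p \<Delta>\<^sub>z = E\<^sub>z + \<Delta>\<^sub>p
  \<Delta>\<^sub>z\<close>. Expanding the product over \<open>p\<close> gives the terms
  \<open>e\<^sub>i(\<Delta>) \<Delta>\<^sub>z\<^sup>i E\<^sub>z\<^sup>m\<^sup>-\<^sup>i\<close> with
  \<open>m = length l\<close>.\<close>

lemma last_op_closed:
  "last_op f l z = (\<Sum>i\<le>length l. esym i (\<lambda>q. fdiffs i (\<lambda>x. f (q @ [x])) (z + int (length l) - int i)) l)"
proof (induction l arbitrary: f z)
  case (Cons k l)
  define m where "m = length l"
  define G where "G i a w = esym i (\<lambda>q. fdiffs i (\<lambda>x. f (a # q @ [x])) (w + int m - int i)) l" for i a w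
  have F: "esym i (\<lambda>q. fdiffs (Suc i) (\<lambda>x. f ((a # q) @ [x])) (z + int (Suc m) - int (Suc i))) l = G i a (z + 1) - G i a z" for i a
  proof -
    have "z + int (Suc m) - int (Suc i) = z + int m - int i" "z + int m - int i + 1 = z + 1 + int m - int i"
      by simp_all
    then show ?thesis
      by (simp only: fdiffs_Suc esym_diff G_def append_Cons)
  qed
  have F': "esym (Suc i) (\<lambda>q. fdiffs (Suc i) (\<lambda>x. f ((k # q) @ [x])) (z + int (Suc m) - int (Suc i))) l = G (Suc i) k (z + 1)" for i
  proof -
    have "z + int (Suc m) - int (Suc i) = z + 1 + int m - int (Suc i)" by simp
    then show ?thesis by (simp only: G_def append_Cons)
  qed
  have "(\<Sum>i\<le>length (k # l). esym i (\<lambda>q. fdiffs i (\<lambda>x. f (q @ [x])) (z + int (length (k # l)) - int i)) (k # l))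
    = (\<Sum>i\<le>Suc m. esym i (\<lambda>q. fdiffs i (\<lambda>x. f (q @ [x])) (z + int (Suc m) - int i)) (k # l))"
    by (simp only: m_def list.size Nat.add_0_right add_Suc_right)
  also have "\<dots> = G 0 k (z + 1) + (\<Sum>i\<le>m. G (Suc i) k (z + 1) + (G i (k + 1) (z + 1) - G i (k + 1) z - (G i k (z + 1) - G i k z)))"
    unfolding sum.atMost_Suc_shift esym.simps esym_diff F F'
    by (simp add: G_def algebra_simps)
  also have "\<dots> = (\<Sum>i\<le>Suc m. G i k (z + 1)) + (\<Sum>i\<le>m. G i (k + 1) (z + 1) - G i (k + 1) z - (G i k (z + 1) - G i k z))"
    by (subst sum.atMost_Suc_shift) (simp only: sum.distrib add.assoc)
  also have "(\<Sum>i\<le>Suc m. G i k (z + 1)) = (\<Sum>i\<le>m. G i k (z + 1))"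
    by (simp add: G_def m_def esym_gt)
  also have "\<dots> + (\<Sum>i\<le>m. G i (k + 1) (z + 1) - G i (k + 1) z - (G i k (z + 1) - G i k z))
    = (\<Sum>i\<le>m. G i k z) + (\<Sum>i\<le>m. G i (k + 1) (z + 1)) - (\<Sum>i\<le>m. G i (k + 1) z)"
    by (simp add: sum_subtractf)
  also have "\<dots> = last_op f (k # l) z"
    by (simp add: Cons.IH G_def m_def)
  finally show ?case by simp
qed simp

section \<open>Rotation of the arguments\<close>

lemma antisym_fun_snoc:
  "antisym_fun n f \<Longrightarrow> length pre + Suc (length l) = n \<Longrightarrow> f (pre @ l @ [x]) = (-1) ^ length l * f (pre @ x # l)"
proof (induction l arbitrary: pre)
  case (Cons y l)
  have "f ((pre @ [y]) @ l @ [x]) = (-1) ^ length l * f ((pre @ [y]) @ x # l)"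
    by (rule Cons.IH) (use Cons.prems in auto)
  moreover have "f (pre @ y # x # l) = - f (pre @ x # y # l)"
    by (rule antisym_funD) (use Cons.prems in auto)
  ultimately show ?case by simp
qed simp

lemma esym_fdiffs: "esym i (\<lambda>l. fdiffs j (\<lambda>x. F x l) y) l = fdiffs j (\<lambda>x. esym i (F x) l) y"
  by (induction j arbitrary: y) (simp_all add: fdiff_def esym_diff)

text \<open>Annihilation by degree \<open>i + 1\<close> in all variables says that degree
  \<open>i + 1\<close> in the remaining ones equals \<open>- \<Delta>\<^sub>1\<close> applied to
  degree \<open>i\<close>; iterate.\<close>

lemma esym_gt_iter_Cons:
  assumes "Suc (length l) = n"
  shows "esym i (\<lambda>q. gt_iter n (k # q)) l = (-1) ^ i * fdiffs i (\<lambda>x. gt_iter n (x # l)) k"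
proof (induction i arbitrary: k)
  case (Suc i)
  have "esym (Suc i) (\<lambda>q. gt_iter n (k # q)) l + esym i (\<lambda>q. gt_iter n ((k + 1) # q) - gt_iter n (k # q)) l = 0"
    using esym_gt_iter[of "k # l" n i] assms by simp
  then show ?case
    unfolding esym_diff Suc fdiffs_Suc by (simp add: algebra_simps)
qed simp

text \<open>Splitting off the first variable on the left and the last one on the right leaves
  \<open>cross_op\<close> on \<open>ks\<close> of two functions. By \<open>esym_gt_iter_Cons\<close>
  and antisymmetry these are the two series of \<open>geometric_identity\<close>.\<close>

theorem mt_rotate:
  assumes "Suc (length ks) = n"
  shows "mt n (k # ks) = (-1) ^ length ks * mt n (ks @ [k - int n])"
proof -
  define m where "m = length ks"
  have "(\<Sum>i\<le>m. esym i (\<lambda>q. gt_iter n ((k + int i) # q)) l) = (-1) ^ m * last_op (gt_iter n) l (k - int n)"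
    if l: "length l = length ks" for l
  proof -
    define p where "p x = gt_iter n (x # l)" for x
    have n: "n = Suc m" "Suc (length l) = n" using assms l by (auto simp: m_def)
    have esym: "esym i (\<lambda>q. gt_iter n (x # q)) l = (-1) ^ i * fdiffs i p x" for i x
      using esym_gt_iter_Cons[OF n(2)] by (simp add: p_def[abs_def])
    have "fdiffs n p x = 0" for x
    proof -
      have "esym n (\<lambda>q. gt_iter n (x # q)) l = 0" by (rule esym_gt) (use n in simp)
      then show ?thesis by (simp add: esym)
    qed
    note geo = geometric_identity[OF this, of k]
    have "last_op (gt_iter n) l (k - int n) = (\<Sum>i\<le>m. esym i (\<lambda>q. fdiffs i (\<lambda>x. gt_iter n (q @ [x])) (k - 1 - int i)) l)"
    proof -
      \<comment> \<open>The shift by \<open>n\<close> in the rotated argument is the one that yields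
        the evaluation points of \<open>geometric_identity\<close>.\<close>
      have "k - int n + int (length l) - int i = k - 1 - int i" for i using n by simp
      then show ?thesis using l by (simp only: last_op_closed m_def)
    qed
    also have "\<dots> = (\<Sum>i\<le>m. fdiffs i (\<lambda>x. esym i (\<lambda>q. (-1) ^ m * gt_iter n (x # q)) l) (k - 1 - int i))"
      unfolding esym_fdiffs
    proof (intro sum.cong refl)
      fix i
      have "esym i (\<lambda>q. gt_iter n (q @ [x])) l = esym i (\<lambda>q. (-1) ^ m * gt_iter n (x # q)) l" for x
      proof (rule esym_cong)
        fix q :: "int list" assume q: "length q = length l"
        then have "length [] + Suc (length q) = n" using n(2) by simp
        from antisym_fun_snoc[OF gt_iter_antisym_fun this] show "gt_iter n (q @ [x]) = (-1) ^ m * gt_iter n (x # q)"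
          by (simp only: q l m_def append_Nil)
      qed
      then show "fdiffs i (\<lambda>x. esym i (\<lambda>q. gt_iter n (q @ [x])) l) (k - 1 - int i)
        = fdiffs i (\<lambda>x. esym i (\<lambda>q. (-1) ^ m * gt_iter n (x # q)) l) (k - 1 - int i)" by simp
    qed
    also have "\<dots> = (-1) ^ m * (\<Sum>i\<le>m. (-1) ^ i * fdiffs (2 * i) p (k - 1 - int i))"
    proof -
      have "esym i (\<lambda>q. (-1) ^ m * gt_iter n (x # q)) l = (-1) ^ m * ((-1) ^ i * fdiffs i p x)" for i x
        unfolding esym[symmetric] by (cases "even m") (simp_all add: esym_uminus)
      then show ?thesis
        by (simp add: fdiffs_cmult fdiffs_fdiffs sum_distrib_left mult_2)
    qed
    finally have "(-1) ^ m * last_op (gt_iter n) l (k - int n) = (\<Sum>i\<le>m. (-1) ^ i * fdiffs (2 * i) p (k - 1 - int i))"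
      by simp
    then show ?thesis
      using geo unfolding esym unfolding n(1) lessThan_Suc_atMost by (simp only:)
  qed
  then have "cross_op (gt_iter n) (k # ks) = cross_op (\<lambda>l. (-1) ^ m * last_op (gt_iter n) l (k - int n)) ks"
    unfolding cross_op.simps m_def[symmetric] by (intro cross_op_cong) (simp add: m_def)
  also have "\<dots> = (-1) ^ m * cross_op (\<lambda>l. last_op (gt_iter n) l (k - int n)) ks"
    by (cases "even m") (simp_all add: cross_op_uminus)
  finally show ?thesis
    by (simp add: mt_def cross_op_snoc m_def)
qed

section \<open>Interlacing sequences and rows\<close>

definition interlaces :: "int list \<Rightarrow> int list \<Rightarrow> bool" where
  "interlaces ks l \<longleftrightarrow> length ks = Suc (length l) \<and> sorted_wrt (<) l \<and> (\<forall>i<length l. ks ! i \<le> l ! i \<and> l ! i \<le> ks ! Suc i)"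

text \<open>If \<open>a = k2\<close>, strictness makes the next entry at least
  \<open>k2 + 1\<close>; raising the head expresses this and mirrors the recursion of
  \<open>seqsum\<close>.\<close>

lemma interlaces_Cons:
  assumes "k1 \<le> k2"
  shows "interlaces (k1 # k2 # r) (a # l) \<longleftrightarrow> k1 \<le> a \<and> a \<le> k2 \<and> (if a = k2 then interlaces ((k2 + 1) # r) l else interlaces (k2 # r) l)"
proof (cases l)
  case Nil
  then show ?thesis by (auto simp: interlaces_def)
next
  case (Cons b m)
  have "(\<forall>i<length (a # l). (k1 # k2 # r) ! i \<le> (a # l) ! i \<and> (a # l) ! i \<le> (k1 # k2 # r) ! Suc i) \<longleftrightarrow>
    k1 \<le> a \<and> a \<le> k2 \<and> k2 \<le> b \<and> b \<le> r ! 0 \<and> (\<forall>i<length m. r ! i \<le> m ! i \<and> m ! i \<le> r ! Suc i)"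
    by (simp add: Cons All_less_Suc2)
  moreover have "(\<forall>i<length l. (c # r) ! i \<le> l ! i \<and> l ! i \<le> (c # r) ! Suc i) \<longleftrightarrow>
    c \<le> b \<and> b \<le> r ! 0 \<and> (\<forall>i<length m. r ! i \<le> m ! i \<and> m ! i \<le> r ! Suc i)" for c
    by (simp add: Cons All_less_Suc2)
  moreover have "sorted_wrt (<) (a # l) \<longleftrightarrow> a < b \<and> sorted_wrt (<) l"
    by (auto simp: Cons)
  ultimately show ?thesis
    unfolding interlaces_def by auto
qed

text \<open>The head may equal the next entry, because the recursive call raises it to
  \<open>k2 + 1\<close>.\<close>

lemma seqsum_eq_sum:
  "ks \<noteq> [] \<Longrightarrow> sorted_wrt (<) (tl ks) \<Longrightarrow> (tl ks \<noteq> [] \<longrightarrow> hd ks \<le> hd (tl ks)) \<Longrightarrow>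
    finite {l. interlaces ks l} \<and> seqsum f ks = (\<Sum>l | interlaces ks l. f l)"
proof (induction f ks rule: seqsum.induct)
  case (2 f k)
  have "{l. interlaces [k] l} = {[]}" by (auto simp: interlaces_def)
  then show ?case by simp
next
  case (3 f k1 k2 ks)
  have k: "k1 \<le> k2" "sorted_wrt (<) (k2 # ks)" using 3 by auto
  define I where "I = {l. interlaces (k2 # ks) l}"
  define J where "J = {l. interlaces ((k2 + 1) # ks) l}"
  have IH1: "finite I" "seqsum (\<lambda>m. f (a # m)) (k2 # ks) = (\<Sum>l\<in>I. f (a # l))" for a
    using 3(1)[of a] k by (cases ks; auto simp: I_def)+
  have IH2: "finite J" "seqsum (\<lambda>m. f (k2 # m)) ((k2 + 1) # ks) = (\<Sum>l\<in>J. f (k2 # l))"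
    using 3(2) k by (cases ks; auto simp: J_def)+
  have eq: "{l. interlaces (k1 # k2 # ks) l} = (\<lambda>(a, l). a # l) ` ({k1..<k2} \<times> I) \<union> (#) k2 ` J" (is "?A = ?B")
  proof (rule set_eqI)
    fix l
    show "l \<in> ?A \<longleftrightarrow> l \<in> ?B"
    proof (cases l)
      case Nil
      then show ?thesis by (auto simp: interlaces_def)
    next
      case (Cons a m)
      have "a # m \<in> ?A \<longleftrightarrow> k1 \<le> a \<and> a \<le> k2 \<and> (if a = k2 then m \<in> J else m \<in> I)"
        using interlaces_Cons[OF k(1)] by (simp add: I_def J_def)
      also have "\<dots> \<longleftrightarrow> a # m \<in> ?B"
        using k(1) by (auto simp: image_iff)
      finally show ?thesis by (simp only: Cons)
    qed
  qed
  have inj: "inj_on (\<lambda>(a, l). a # l) ({k1..<k2} \<times> I)" "inj_on ((#) k2) J"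
    by (auto simp: inj_on_def)
  have "(\<Sum>l\<in>?A. f l) = (\<Sum>l\<in>(\<lambda>(a, l). a # l) ` ({k1..<k2} \<times> I). f l) + (\<Sum>l\<in>(#) k2 ` J. f l)"
    unfolding eq by (rule sum.union_disjoint) (use IH1 IH2 in auto)
  also have "\<dots> = (\<Sum>(a, l)\<in>{k1..<k2} \<times> I. f (a # l)) + (\<Sum>l\<in>J. f (k2 # l))"
    unfolding sum.reindex[OF inj(1)] sum.reindex[OF inj(2)] by (simp add: case_prod_unfold)
  also have "\<dots> = seqsum f (k1 # k2 # ks)"
    using k(1) by (simp add: IH1 IH2 signed_sum_def sum.cartesian_product)
  finally show ?case
    using IH1 IH2 eq by simp
qed simp

section \<open>Finite sets of columns as increasing lists\<close>

lemma nth_less_iff_filter: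
  fixes xs :: "nat list"
  shows "sorted_wrt (<) xs \<Longrightarrow> i < length xs \<Longrightarrow> xs ! i < x \<longleftrightarrow> i < length (filter (\<lambda>y. y < x) xs)"
proof (induction xs arbitrary: i)
  case (Cons y ys)
  show ?case
  proof (cases "y < x")
    case True
    then show ?thesis using Cons by (cases i) auto
  next
    case False
    then have "filter (\<lambda>z. z < x) (y # ys) = []"
      using Cons.prems(1) by (auto simp: filter_empty_conv)
    moreover have "\<not> (y # ys) ! i < x"
    proof (cases i)
      case (Suc k)
      then have "ys ! k \<in> set ys" using Cons.prems(2) by simp
      then show ?thesis using Suc False Cons.prems(1) by force
    qed (use False in simp)
    ultimately show ?thesis by simp
  qed
qed simp

lemma nth_sorted_list_less_iff:
  fixes S :: "nat set"
  assumes "finite S" "i < card S"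
  shows "sorted_list_of_set S ! i < x \<longleftrightarrow> i < card (S \<inter> {..<x})"
proof -
  have "card (S \<inter> {..<x}) = length (filter (\<lambda>y. y < x) (sorted_list_of_set S))"
    using assms(1) distinct_card[of "filter (\<lambda>y. y < x) (sorted_list_of_set S)"]
    by (simp add: Int_def)
  then show ?thesis
    using nth_less_iff_filter[of "sorted_list_of_set S" i x] assms by simp
qed

definition sorted_ints :: "nat set \<Rightarrow> int list" where
  "sorted_ints S = map int (sorted_list_of_set S)"

lemma length_sorted_ints [simp]: "length (sorted_ints S) = card S"
  by (simp add: sorted_ints_def)

lemma sorted_sorted_ints: "sorted_wrt (<) (sorted_ints S)"
  by (simp add: sorted_ints_def sorted_wrt_map)

lemma sorted_ints_of_sorted:
  assumes "sorted_wrt (<) l" "\<forall>x\<in>set l. 0 \<le> x"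
  shows "sorted_ints (nat ` set l) = l"
proof -
  have "sorted_wrt (<) (map nat l)"
    unfolding sorted_wrt_map by (rule sorted_wrt_mono_rel[OF _ assms(1)]) (use assms(2) in auto)
  then have "sorted_list_of_set (set (map nat l)) = map nat l"
    by (intro sorted_list_of_set.idem_if_sorted_distinct) (auto simp: strict_sorted_iff)
  then have "sorted_ints (nat ` set l) = map int (map nat l)"
    by (simp add: sorted_ints_def)
  also have "\<dots> = l"
    using assms(2) by (simp add: map_idI)
  finally show ?thesis .
qed

text \<open>The lower bounds on the entries of \<open>S'\<close> amount to \<open>c' \<le> c\<close>
  for the counting functions, the upper bounds to \<open>c \<le> c' + 1\<close>. In this form
  interlacing is a condition on the partial sums of a row.\<close>

lemma interlaces_sorted_ints_iff:
  assumes "finite S" "finite S'"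
  shows "interlaces (sorted_ints S) (sorted_ints S') \<longleftrightarrow> card S = Suc (card S') \<and>
    (\<forall>x. card (S' \<inter> {..<x}) \<le> card (S \<inter> {..<x}) \<and> card (S \<inter> {..<x}) \<le> Suc (card (S' \<inter> {..<x})))"
proof -
  define c where "c x = card (S \<inter> {..<x})" for x
  define c' where "c' x = card (S' \<inter> {..<x})" for x
  let ?k = "sorted_list_of_set S" and ?l = "sorted_list_of_set S'"
  have k: "?k ! i < x \<longleftrightarrow> i < c x" if "i < card S" for i x
    using nth_sorted_list_less_iff[OF assms(1) that] by (simp add: c_def)
  have l: "?l ! i < x \<longleftrightarrow> i < c' x" if "i < card S'" for i x
    using nth_sorted_list_less_iff[OF assms(2) that] by (simp add: c'_def)
  have cl: "c x \<le> card S" "c' x \<le> card S'" for x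
    unfolding c_def c'_def by (auto intro!: card_mono assms)
  have "interlaces (sorted_ints S) (sorted_ints S') \<longleftrightarrow> card S = Suc (card S') \<and> (\<forall>i<card S'. ?k ! i \<le> ?l ! i \<and> ?l ! i \<le> ?k ! Suc i)"
    unfolding interlaces_def using sorted_sorted_ints by (auto simp: sorted_ints_def)
  also have "\<dots> \<longleftrightarrow> card S = Suc (card S') \<and> (\<forall>x. c' x \<le> c x \<and> c x \<le> Suc (c' x))"
  proof (intro conj_cong refl iffI allI impI)
    fix x
    assume card: "card S = Suc (card S')" and il: "\<forall>i<card S'. ?k ! i \<le> ?l ! i \<and> ?l ! i \<le> ?k ! Suc i"
    show "c' x \<le> c x \<and> c x \<le> Suc (c' x)"
    proof (rule ccontr)
      assume "\<not> ?thesis"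
      then consider "c x < c' x" | "Suc (c' x) < c x" by linarith
      then show False
      proof cases
        case 1
        then have "c x < card S'" using cl[of x] by simp
        then show False using k[of "c x" x] l[of "c x" x] il 1 card by fastforce
      next
        case 2
        then have "c' x < card S'" using cl[of x] card by simp
        then show False using k[of "Suc (c' x)" x] l[of "c' x" x] il 2 card by fastforce
      qed
    qed
  next
    fix i
    assume card: "card S = Suc (card S')" and c: "\<forall>x. c' x \<le> c x \<and> c x \<le> Suc (c' x)" and i: "i < card S'"
    have "i < c' (Suc (?l ! i))" using l[OF i] by blast
    then have "i < c (Suc (?l ! i))" using c by (meson order_less_le_trans)
    then have 1: "?k ! i \<le> ?l ! i" using k[of i "Suc (?l ! i)"] i card by simp
    have "Suc i < c (Suc (?k ! Suc i))" using k[of "Suc i" "Suc (?k ! Suc i)"] i card by simp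
    also have "\<dots> \<le> Suc (c' (Suc (?k ! Suc i)))" using c by blast
    finally have "?l ! i \<le> ?k ! Suc i" using l[OF i, of "Suc (?k ! Suc i)"] by simp
    with 1 show "?k ! i \<le> ?l ! i \<and> ?l ! i \<le> ?k ! Suc i" by simp
  qed
  finally show ?thesis by (simp add: c_def c'_def)
qed

text \<open>\<open>S\<close> and \<open>S'\<close> are the columns with sum 1 after row
  \<open>r\<close> and before it, so row \<open>r\<close> is the difference of their indicator
  functions. The clauses give its support, the alternation starting with 1, and the row sum.\<close>

definition rowrel :: "nat \<Rightarrow> nat \<Rightarrow> nat set \<Rightarrow> nat set \<Rightarrow> bool" where
  "rowrel n r S S' \<longleftrightarrow> (\<forall>j. j \<notin> {r..2 * n - r} \<longrightarrow> (j \<in> S \<longleftrightarrow> j \<in> S')) \<and>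
     (\<forall>x. (\<Sum>j<x. of_bool (j \<in> S) - of_bool (j \<in> S') :: int) \<in> {0, 1}) \<and>
     (\<Sum>j<2 * n. of_bool (j \<in> S) - of_bool (j \<in> S') :: int) = 1"

lemma finite_rowrel: "finite {S'. rowrel n r S S'}"
proof (rule finite_subset)
  show "{S'. rowrel n r S S'} \<subseteq> (\<lambda>T. (S - {r..2 * n - r}) \<union> T) ` Pow {r..2 * n - r}"
  proof
    fix S' assume "S' \<in> {S'. rowrel n r S S'}"
    then have "S' = (S - {r..2 * n - r}) \<union> (S' \<inter> {r..2 * n - r})"
      by (auto simp: rowrel_def)
    then show "S' \<in> (\<lambda>T. (S - {r..2 * n - r}) \<union> T) ` Pow {r..2 * n - r}" by blast
  qed
qed simp

lemma sum_of_bool_diff: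
  fixes x :: nat
  shows "(\<Sum>j<x. of_bool (j \<in> S) - of_bool (j \<in> S') :: int) = int (card (S \<inter> {..<x})) - int (card (S' \<inter> {..<x}))"
proof -
  have "(\<Sum>j<x. of_bool (j \<in> S) :: int) = int (card (S \<inter> {..<x}))" for S
    by (simp add: Int_commute)
  then show ?thesis by (simp add: sum_subtractf)
qed

lemma rowrel_subset:
  assumes "rowrel n r S S'" "S \<subseteq> A" "{r..2 * n - r} \<subseteq> A"
  shows "S' \<subseteq> A"
proof
  fix j assume "j \<in> S'"
  with assms show "j \<in> A"
    by (cases "j \<in> {r..2 * n - r}") (auto simp: rowrel_def)
qed

lemma rowrel_card:
  assumes "rowrel n r S S'" "S \<subseteq> {..<2 * n}" "1 \<le> r" "1 \<le> n"
  shows "card S = Suc (card S')"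
proof -
  have "2 * n - r < 2 * n" using assms(3,4) by simp
  then have "{r..2 * n - r} \<subseteq> {..<2 * n}" by auto
  then have "S' \<subseteq> {..<2 * n}" by (rule rowrel_subset[OF assms(1,2)])
  then have "int (card S) - int (card S') = 1"
    using assms(1,2) unfolding rowrel_def sum_of_bool_diff by (simp add: Int_absorb2)
  then show ?thesis by simp
qed

lemma rowrel_iff_interlaces:
  assumes "S \<subseteq> {r..2 * n - r}" "1 \<le> r" "1 \<le> n" "S' \<subseteq> {r..2 * n - r}"
  shows "rowrel n r S S' \<longleftrightarrow> interlaces (sorted_ints S) (sorted_ints S')"
proof -
  have fin: "finite S" "finite S'" using assms finite_subset by blast+
  have "2 * n - r < 2 * n" using assms(2,3) by simp
  then have sub: "S \<inter> {..<2 * n} = S" "S' \<inter> {..<2 * n} = S'" using assms(1,4) by force+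
  have "rowrel n r S S' \<longleftrightarrow> (\<forall>x. int (card (S \<inter> {..<x})) - int (card (S' \<inter> {..<x})) \<in> {0, 1}) \<and> int (card S) - int (card S') = 1"
    using assms unfolding rowrel_def sum_of_bool_diff sub by blast
  also have "\<dots> \<longleftrightarrow> interlaces (sorted_ints S) (sorted_ints S')"
    unfolding interlaces_sorted_ints_iff[OF fin] by (smt (verit) insertCI insertE singletonD of_nat_Suc of_nat_le_iff of_nat_eq_iff)
  finally show ?thesis .
qed

text \<open>Passing to sorted lists is a bijection onto the interlacing lists: interlacing with
  \<open>S\<close> keeps the entries within the columns of row \<open>r\<close>.\<close>

lemma sum_rowrel:
  assumes S: "S \<subseteq> {r..2 * n - r}" and r: "1 \<le> r" "1 \<le> n"
  shows "(\<Sum>S' | rowrel n r S S'. f (sorted_ints S')) = seqsum f (sorted_ints S)"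
proof (cases "S = {}")
  case True
  \<comment> \<open>The sum is empty, in agreement with the value 0 of \<open>seqsum\<close> at the
    empty list.\<close>
  have "\<not> rowrel n r {} S'" for S'
    using rowrel_card[of n r "{}" S'] r by auto
  then show ?thesis by (simp add: True sorted_ints_def)
next
  case False
  have fin: "finite S" using S finite_subset by blast
  have ne: "sorted_ints S \<noteq> []" using False fin by (simp add: sorted_ints_def)
  have bij: "bij_betw sorted_ints {S'. rowrel n r S S'} {l. interlaces (sorted_ints S) l}"
  proof (rule bij_betw_byWitness[where f' = "\<lambda>l. nat ` set l"])
    have sub: "S' \<subseteq> {r..2 * n - r}" if "rowrel n r S S'" for S'
      using rowrel_subset[OF that S] by simp
    have fin': "finite S'" if "rowrel n r S S'" for S'
      using sub[OF that] finite_subset by blast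
    show "\<forall>S'\<in>{S'. rowrel n r S S'}. nat ` set (sorted_ints S') = S'"
      using fin' by (auto simp: sorted_ints_def image_image)
    have l: "set l \<subseteq> {int r..int (2 * n - r)}" if l: "interlaces (sorted_ints S) l" for l
    proof
      fix x assume "x \<in> set l"
      then obtain i where i: "i < length l" "x = l ! i" by (auto simp: in_set_conv_nth)
      then have "sorted_ints S ! i \<le> x" "x \<le> sorted_ints S ! Suc i" "Suc i < length (sorted_ints S)"
        using l by (auto simp: interlaces_def)
      moreover have "set (sorted_ints S) \<subseteq> {int r..int (2 * n - r)}"
        using S fin by (auto simp: sorted_ints_def)
      moreover have "sorted_ints S ! i \<in> set (sorted_ints S)" "sorted_ints S ! Suc i \<in> set (sorted_ints S)"
        using calculation(3) by (auto intro!: nth_mem simp del: length_sorted_ints)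
      ultimately have "sorted_ints S ! i \<in> {int r..int (2 * n - r)}" "sorted_ints S ! Suc i \<in> {int r..int (2 * n - r)}"
        by blast+
      with \<open>sorted_ints S ! i \<le> x\<close> \<open>x \<le> sorted_ints S ! Suc i\<close> show "x \<in> {int r..int (2 * n - r)}" by simp
    qed
    have inv: "sorted_ints (nat ` set l) = l" if "interlaces (sorted_ints S) l" for l
      using l[OF that] that by (intro sorted_ints_of_sorted) (auto simp: interlaces_def)
    then show "\<forall>l\<in>{l. interlaces (sorted_ints S) l}. sorted_ints (nat ` set l) = l" by simp
    show "sorted_ints ` {S'. rowrel n r S S'} \<subseteq> {l. interlaces (sorted_ints S) l}"
      using rowrel_iff_interlaces[OF S r sub] by auto
    show "(\<lambda>l. nat ` set l) ` {l. interlaces (sorted_ints S) l} \<subseteq> {S'. rowrel n r S S'}"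
    proof (clarify)
      fix l assume il: "interlaces (sorted_ints S) l"
      have "nat ` set l \<subseteq> {r..2 * n - r}" using l[OF il] by force
      then show "rowrel n r S (nat ` set l)"
        using rowrel_iff_interlaces[OF S r] inv[OF il] il by simp
    qed
  qed
  have "sorted_wrt (<) (tl (sorted_ints S)) \<and> (tl (sorted_ints S) \<noteq> [] \<longrightarrow> hd (sorted_ints S) \<le> hd (tl (sorted_ints S)))"
    using sorted_sorted_ints[of S] ne by (cases "sorted_ints S") (auto simp: neq_Nil_conv)
  then have "seqsum f (sorted_ints S) = (\<Sum>l | interlaces (sorted_ints S) l. f l)"
    using seqsum_eq_sum[OF ne] by blast
  then show ?thesis
    using sum.reindex_bij_betw[OF bij, of f] by simp
qed

section \<open>Counting chains of column sets\<close>

fun chain_count :: "nat \<Rightarrow> nat \<Rightarrow> nat set \<Rightarrow> int" where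
  "chain_count n 0 S = of_bool (S = {})"
| "chain_count n (Suc r) S = (\<Sum>S' | rowrel n (Suc r) S S'. chain_count n r S')"

text \<open>A column that already ended above row \<open>r + 1\<close> does not influence that row.\<close>

lemma chain_count_Suc_insert:
  assumes "c \<notin> {Suc r..2 * n - Suc r}" "c \<notin> M"
  shows "chain_count n (Suc r) (insert c M) = (\<Sum>M' | rowrel n (Suc r) M M'. chain_count n r (insert c M'))"
proof -
  have c: "c \<notin> M'" if "rowrel n (Suc r) M M'" for M'
    using that assms by (auto simp: rowrel_def)
  have ins: "rowrel n (Suc r) (insert c M) (insert c M') \<longleftrightarrow> rowrel n (Suc r) M M'" if "c \<notin> M'" for M'
  proof -
    have "of_bool (j \<in> insert c M) - of_bool (j \<in> insert c M') = (of_bool (j \<in> M) - of_bool (j \<in> M') :: int)" for j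
      using assms(2) that by auto
    moreover have "(j \<in> insert c M \<longleftrightarrow> j \<in> insert c M') \<longleftrightarrow> (j \<in> M \<longleftrightarrow> j \<in> M')" for j
      using assms(2) that by auto
    ultimately show ?thesis by (simp only: rowrel_def)
  qed
  have "{S'. rowrel n (Suc r) (insert c M) S'} = insert c ` {M'. rowrel n (Suc r) M M'}"
  proof (intro set_eqI iffI)
    fix S' assume S': "S' \<in> {S'. rowrel n (Suc r) (insert c M) S'}"
    then have "c \<in> S'" using assms(1) by (auto simp: rowrel_def)
    then have "S' = insert c (S' - {c})" by blast
    moreover have "rowrel n (Suc r) M (S' - {c})"
      using S' ins[of "S' - {c}"] calculation by simp
    ultimately show "S' \<in> insert c ` {M'. rowrel n (Suc r) M M'}" by blast
  qed (use c ins in auto)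
  moreover have "inj_on (insert c) {M'. rowrel n (Suc r) M M'}"
    using c by (auto simp: inj_on_def insert_ident)
  ultimately show ?thesis by (simp add: sum.reindex)
qed

text \<open>As the rows widen upwards, no column of an earlier set has ended either, and the
  recursion is that of \<open>mt\<close>.\<close>

lemma chain_count_eq_mt:
  "S \<subseteq> {r..2 * n - r} \<Longrightarrow> card S = r \<Longrightarrow> r \<le> n \<Longrightarrow> chain_count n r S = mt r (sorted_ints S)"
proof (induction r arbitrary: S)
  case 0
  then have "S = {}" using finite_subset[of S "{0..2 * n - 0}"] by auto
  then show ?case by (simp add: sorted_ints_def)
next
  case (Suc r)
  have "chain_count n (Suc r) S = (\<Sum>S' | rowrel n (Suc r) S S'. mt r (sorted_ints S'))"
    unfolding chain_count.simps
  proof (rule sum.cong)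
    fix S' assume "S' \<in> {S'. rowrel n (Suc r) S S'}"
    then have S': "rowrel n (Suc r) S S'" by simp
    show "chain_count n r S' = mt r (sorted_ints S')"
    proof (rule Suc.IH)
      have "{Suc r..2 * n - Suc r} \<subseteq> {r..2 * n - r}" by auto
      then show "S' \<subseteq> {r..2 * n - r}" using Suc.prems(1) by (intro rowrel_subset[OF S']) blast+
      have "{Suc r..2 * n - Suc r} \<subseteq> {..<2 * n}" using Suc.prems(3) by auto
      then have "S \<subseteq> {..<2 * n}" using Suc.prems(1) by blast
      then show "card S' = r" using rowrel_card[OF S'] Suc.prems by simp
    qed (use Suc.prems in simp)
  qed simp
  also have "\<dots> = seqsum (mt r) (sorted_ints S)"
    by (rule sum_rowrel) (use Suc.prems in auto)
  also have "\<dots> = mt (Suc r) (sorted_ints S)"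
    using Suc.prems by (simp add: mt_Suc)
  finally show ?case .
qed

lemma sorted_ints_insert_greatest:
  assumes "finite M" "\<forall>x\<in>M. x < c"
  shows "sorted_ints (insert c M) = sorted_ints M @ [int c]"
proof -
  have "sorted_ints (nat ` set (sorted_ints M @ [int c])) = sorted_ints M @ [int c]"
    by (rule sorted_ints_of_sorted) (use assms sorted_sorted_ints[of M] in \<open>auto simp: sorted_wrt_append sorted_ints_def\<close>)
  moreover have "nat ` set (sorted_ints M @ [int c]) = insert c M"
    using assms(1) by (auto simp: sorted_ints_def image_image)
  ultimately show ?thesis by simp
qed

lemma sorted_ints_insert_least:
  assumes "finite M" "\<forall>x\<in>M. c < x"
  shows "sorted_ints (insert c M) = int c # sorted_ints M"
proof -
  have "sorted_ints (nat ` set (int c # sorted_ints M)) = int c # sorted_ints M"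
    by (rule sorted_ints_of_sorted) (use assms sorted_sorted_ints[of M] in \<open>auto simp: sorted_ints_def\<close>)
  moreover have "nat ` set (int c # sorted_ints M) = insert c M"
    using assms(1) by (auto simp: sorted_ints_def image_image)
  ultimately show ?thesis by simp
qed

text \<open>For \<open>t < r\<close>, column \<open>2 * n - r + t\<close> ends in row
  \<open>r - t\<close>. Each of the \<open>t\<close> rows below leaves it fixed, and peeling such a
  row off is one difference in the last argument. At \<open>t = 0\<close> the column is the right
  end of its row.\<close>

lemma chain_count_right_column:
  "M \<subseteq> {r..<2 * n - r} \<Longrightarrow> Suc (card M) = r \<Longrightarrow> r \<le> n \<Longrightarrow>
    chain_count n r (insert (2 * n - r + t) M) = fdiffs t (\<lambda>x. mt r (sorted_ints M @ [x])) (int (2 * n - r))"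
proof (induction t arbitrary: r M)
  case 0
  have fin: "finite M" using 0(1) finite_subset by blast
  have "chain_count n r (insert (2 * n - r) M) = mt r (sorted_ints (insert (2 * n - r) M))"
    by (rule chain_count_eq_mt) (use 0 fin in \<open>auto simp: card_insert_if\<close>)
  also have "sorted_ints (insert (2 * n - r) M) = sorted_ints M @ [int (2 * n - r)]"
    by (rule sorted_ints_insert_greatest) (use 0 fin in auto)
  finally show ?case by simp
next
  case (Suc t)
  obtain r' where r: "r = Suc r'" using Suc.prems(2) by (cases r) auto
  have c: "2 * n - r + Suc t = 2 * n - r' + t" using Suc.prems(3) r by simp
  have card: "card M = r'" using Suc.prems(2) r by simp
  have "chain_count n r (insert (2 * n - r + Suc t) M) = (\<Sum>M' | rowrel n (Suc r') M M'. chain_count n r' (insert (2 * n - r' + t) M'))"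
    unfolding c unfolding r
  proof (rule chain_count_Suc_insert)
    show "2 * n - r' + t \<notin> M"
    proof
      assume "2 * n - r' + t \<in> M"
      then have "2 * n - r' + t \<in> {r..<2 * n - r}" using Suc.prems(1) by blast
      then show False using r by (simp, linarith)
    qed
  qed (use Suc.prems r in auto)
  also have "\<dots> = (\<Sum>M' | rowrel n (Suc r') M M'. fdiffs t (\<lambda>x. mt r' (sorted_ints M' @ [x])) (int (2 * n - r')))"
  proof (rule sum.cong)
    fix M' assume "M' \<in> {M'. rowrel n (Suc r') M M'}"
    then have M': "rowrel n (Suc r') M M'" by simp
    show "chain_count n r' (insert (2 * n - r' + t) M') = fdiffs t (\<lambda>x. mt r' (sorted_ints M' @ [x])) (int (2 * n - r'))"
    proof (rule Suc.IH)
      have "{r..<2 * n - r} \<subseteq> {r'..<2 * n - r'}" "{Suc r'..2 * n - Suc r'} \<subseteq> {r'..<2 * n - r'}"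
        using Suc.prems(3) r by auto
      then show "M' \<subseteq> {r'..<2 * n - r'}" using Suc.prems(1) by (intro rowrel_subset[OF M']) blast+
      have "{r..<2 * n - r} \<subseteq> {..<2 * n}" by auto
      then have "M \<subseteq> {..<2 * n}" using Suc.prems(1) by blast
      then show "Suc (card M') = r'" using rowrel_card[OF M'] card Suc.prems r by simp
    qed (use Suc.prems r in simp)
  qed simp
  also have "\<dots> = seqsum (\<lambda>m. fdiffs t (\<lambda>x. mt r' (m @ [x])) (int (2 * n - r'))) (sorted_ints M)"
    by (rule sum_rowrel) (use Suc.prems r in auto)
  also have "\<dots> = fdiffs (Suc t) (\<lambda>x. mt (Suc r') (sorted_ints M @ [x])) (int (2 * n - r))"
  proof -
    \<comment> \<open>The right end moves by one from row to row, matching the shift in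
      \<open>fdiffs_mt_snoc\<close>.\<close>
    have "int (2 * n - r') = int (2 * n - r) + 1" using Suc.prems(3) r by simp
    moreover have "length (sorted_ints M) = r'" using card by simp
    ultimately show ?thesis by (simp only: fdiffs_mt_snoc)
  qed
  finally show ?case by (simp only: r)
qed

text \<open>In row \<open>i\<close> this is rotation followed by expansion in differences at
  \<open>2 * n - i\<close>, whose terms are counts with the columns \<open>2 * n - i + t\<close>.
  The rows below touch none of these columns and carry the identity down.\<close>

lemma chain_count_column_swap:
  assumes "i \<le> r" "1 \<le> i" "M \<subseteq> {i + 1..<2 * n - i}" "Suc (card M) = r" "r \<le> n"
  shows "chain_count n r (insert i M) =
    (\<Sum>t<i. (-1) ^ (i - 1 + t) * int ((2 * n - i + t - 1) choose t) * chain_count n r (insert (2 * n - i + t) M))"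
  using assms
proof (induction r arbitrary: M rule: dec_induct)
  case base
  have fin: "finite M" using base finite_subset by blast
  have len: "Suc (length (sorted_ints M)) = i" using base by simp
  define f where "f x = mt i (sorted_ints M @ [x])" for x
  have "chain_count n i (insert i M) = mt i (sorted_ints (insert i M))"
    by (rule chain_count_eq_mt) (use base fin in \<open>auto simp: card_insert_if\<close>)
  also have "sorted_ints (insert i M) = int i # sorted_ints M"
    by (rule sorted_ints_insert_least) (use base fin in auto)
  \<comment> \<open>The rotated argument is \<open>i - i = 0\<close>, at distance
    \<open>2 * n - i\<close> from the right end of row \<open>i\<close>.\<close>
  also have "mt i (int i # sorted_ints M) = (-1) ^ (i - 1) * f 0"
    using mt_rotate[OF len, of "int i"] len by (simp add: f_def flip: len)
  also have "f 0 = (\<Sum>t<i. (-1) ^ t * int ((2 * n - i + t - 1) choose t) * fdiffs t f (0 + int (2 * n - i)))"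
    by (rule newton_backward) (simp only: f_def fdiffs_mt_zero[OF len])
  also have "\<dots> = (\<Sum>t<i. (-1) ^ t * int ((2 * n - i + t - 1) choose t) * chain_count n i (insert (2 * n - i + t) M))"
  proof (intro sum.cong refl arg_cong2[where f = "(*)"])
    fix t
    have "chain_count n i (insert (2 * n - i + t) M) = fdiffs t (\<lambda>x. mt i (sorted_ints M @ [x])) (int (2 * n - i))"
      by (rule chain_count_right_column) (use base in auto)
    then show "fdiffs t f (0 + int (2 * n - i)) = chain_count n i (insert (2 * n - i + t) M)"
      by (simp add: f_def[abs_def])
  qed
  finally show ?case
    by (simp only: sum_distrib_left power_add mult.assoc)
next
  case (step r)
  have "chain_count n (Suc r) (insert i M) = (\<Sum>M' | rowrel n (Suc r) M M'. chain_count n r (insert i M'))"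
    by (rule chain_count_Suc_insert) (use step in auto)
  also have "\<dots> = (\<Sum>M' | rowrel n (Suc r) M M'. \<Sum>t<i. (-1) ^ (i - 1 + t) *
      int ((2 * n - i + t - 1) choose t) * chain_count n r (insert (2 * n - i + t) M'))"
  proof (rule sum.cong)
    fix M' assume "M' \<in> {M'. rowrel n (Suc r) M M'}"
    then have M': "rowrel n (Suc r) M M'" by simp
    show "chain_count n r (insert i M') = (\<Sum>t<i. (-1) ^ (i - 1 + t) *
      int ((2 * n - i + t - 1) choose t) * chain_count n r (insert (2 * n - i + t) M'))"
    proof (rule step.IH)
      show "M' \<subseteq> {i + 1..<2 * n - i}" by (rule rowrel_subset[OF M']) (use step in auto)
      have "{i + 1..<2 * n - i} \<subseteq> {..<2 * n}" by auto
      then have "M \<subseteq> {..<2 * n}" using step.prems by blast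
      then show "Suc (card M') = r" using rowrel_card[OF M'] step by simp
    qed (use step in auto)
  qed simp
  also have "\<dots> = (\<Sum>t<i. (-1) ^ (i - 1 + t) * int ((2 * n - i + t - 1) choose t) *
      (\<Sum>M' | rowrel n (Suc r) M M'. chain_count n r (insert (2 * n - i + t) M')))"
    by (subst sum.swap) (simp add: sum_distrib_left)
  also have "\<dots> = (\<Sum>t<i. (-1) ^ (i - 1 + t) * int ((2 * n - i + t - 1) choose t) * chain_count n (Suc r) (insert (2 * n - i + t) M))"
  proof (intro sum.cong refl arg_cong2[where f = "(*)"] chain_count_Suc_insert[symmetric])
    fix t
    show "2 * n - i + t \<notin> {Suc r..2 * n - Suc r}"
      using step by auto
    have "2 * n - i + t \<notin> {i + 1..<2 * n - i}" by simp
    then show "2 * n - i + t \<notin> M"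
      using step.prems by blast
  qed
  finally show ?case .
qed

section \<open>Alternating sign triangles as chains of column sets\<close>

text \<open>The partial sum records the last non-zero entry: it is 0 if there is none or if that
  entry is -1, and 1 if that entry is 1.\<close>

lemma alternates_sum_lessThan:
  assumes alt: "alternates f" and val: "\<And>i. f i \<in> {0, 1, -1}"
    and first: "\<And>k. f k \<noteq> 0 \<Longrightarrow> (\<forall>i<k. f i = 0) \<Longrightarrow> f k = 1"
  shows "(\<Sum>i<x. f i) \<in> {0, 1}"
proof -
  define last where "last c x \<longleftrightarrow> (\<exists>i<x. f i = c \<and> (\<forall>m. i < m \<and> m < x \<longrightarrow> f m = 0))" for c x
  have "((\<Sum>i<x. f i) = 0 \<and> ((\<forall>i<x. f i = 0) \<or> last (-1) x)) \<or> ((\<Sum>i<x. f i) = 1 \<and> last 1 x)"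
  proof (induction x)
    case (Suc x)
    show ?case
    proof (cases "f x = 0")
      case True
      have l: "last c (Suc x)" if lc: "last c x" for c
      proof -
        obtain i where "i < x" "f i = c" "\<forall>m. i < m \<and> m < x \<longrightarrow> f m = 0"
          using lc unfolding last_def by blast
        then show ?thesis
          unfolding last_def by (intro exI[of _ i]) (use True in \<open>auto simp: less_Suc_eq\<close>)
      qed
      have "(\<Sum>i<Suc x. f i) = (\<Sum>i<x. f i)" "(\<forall>i<Suc x. f i = 0) \<longleftrightarrow> (\<forall>i<x. f i = 0)"
        using True by (auto simp: less_Suc_eq)
      then show ?thesis using Suc l[of 1] l[of "-1"] by argo
    next
      case False
      then have new: "last (f x) (Suc x)" unfolding last_def by auto
      have next_val: "f x = - c" if lc: "last c x" and c: "c \<noteq> 0" for c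
      proof -
        obtain i where "i < x" "f i = c" "\<forall>m. i < m \<and> m < x \<longrightarrow> f m = 0"
          using lc unfolding last_def by blast
        then show ?thesis
          using alt[unfolded alternates_def, rule_format, of i x] c False by auto
      qed
      consider "\<forall>i<x. f i = 0" "(\<Sum>i<x. f i) = 0" | "last (-1) x" "(\<Sum>i<x. f i) = 0" | "last 1 x" "(\<Sum>i<x. f i) = 1"
        using Suc by meson
      then show ?thesis
      proof cases
        case 1
        then have "f x = 1" by (intro first False)
        then show ?thesis using 1 new by simp
      next
        case 2
        then show ?thesis using next_val[of "-1"] new by simp
      next
        case 3
        then show ?thesis using next_val[of 1] new by simp
      qed
    qed
  qed simp
  then show ?thesis by auto
qed

lemma alternates_if_sum_lessThan:
  fixes f :: "nat \<Rightarrow> int"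
  assumes "\<And>x. (\<Sum>i<x. f i) \<in> {0, 1}"
  shows "alternates f"
  unfolding alternates_def
proof (intro allI impI)
  fix i k
  assume a: "i < k \<and> f i \<noteq> 0 \<and> f k \<noteq> 0 \<and> (\<forall>m. i < m \<and> m < k \<longrightarrow> f m = 0)"
  define P where "P x = (\<Sum>i<x. f i)" for x
  have P: "P x = 0 \<or> P x = 1" for x
    using assms[of x] unfolding P_def by blast
  have PSuc: "P (Suc x) = P x + f x" for x
    by (simp add: P_def)
  have "P x = P (Suc i)" if "Suc i \<le> x" "x \<le> k" for x
    using that
  proof (induction x rule: dec_induct)
    case (step x)
    then have "f x = 0" using a by auto
    then show ?case using step PSuc[of x] by simp
  qed simp
  then have "P k = P i + f i" using a PSuc[of i] by simp
  then show "f k = - f i"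
    using P[of i] P[of k] P[of "Suc k"] PSuc[of k] a by linarith
qed

lemma sum_lessThan_value:
  fixes f :: "nat \<Rightarrow> int"
  assumes "\<And>x. (\<Sum>i<x. f i) \<in> {0, 1}"
  shows "f i \<in> {0, 1, -1}" "(\<forall>i'<i. f i' = 0) \<Longrightarrow> f i \<noteq> 0 \<Longrightarrow> f i = 1"
proof -
  have "(\<Sum>i<Suc i. f i) = (\<Sum>i<i. f i) + f i" by simp
  then show "f i \<in> {0, 1, -1}" using assms[of i] assms[of "Suc i"] by auto
  show "f i = 1" if "\<forall>i'<i. f i' = 0" "f i \<noteq> 0"
    using that assms[of "Suc i"] by simp
qed

text \<open>The first \<open>r\<close> rows of a triangle, where \<open>S\<close> is the set of columns with partial sum \<open>1\<close>.\<close>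

definition partials :: "nat \<Rightarrow> nat \<Rightarrow> nat set \<Rightarrow> (nat \<Rightarrow> nat \<Rightarrow> int) set" where
  "partials n r S = {a. (\<forall>i j. a i j \<noteq> 0 \<longrightarrow> 1 \<le> i \<and> i \<le> r \<and> i \<le> j \<and> j \<le> 2 * n - i) \<and>
     (\<forall>i\<le>r. \<forall>j. (\<Sum>i'\<le>i. a i' j) \<in> {0, 1}) \<and>
     (\<forall>j. (\<Sum>i'\<le>r. a i' j) = of_bool (j \<in> S)) \<and>
     (\<forall>i\<in>{1..r}. (\<forall>x. (\<Sum>j<x. a i j) \<in> {0, 1}) \<and> (\<Sum>j<2 * n. a i j) = 1)}"

lemma partials_0: "partials n 0 S = (if S = {} then {\<lambda>_ _. 0} else {})"
proof -
  have "a = (\<lambda>_ _. 0)" if "a \<in> partials n 0 S" for a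
    using that unfolding partials_def by (intro ext) force
  moreover have "(\<lambda>_ _. 0) \<in> partials n 0 S \<longleftrightarrow> S = {}"
    by (auto simp: partials_def)
  ultimately show ?thesis by auto
qed

lemma partialsI:
  assumes "\<And>i j. a i j \<noteq> 0 \<Longrightarrow> 1 \<le> i \<and> i \<le> r \<and> i \<le> j \<and> j \<le> 2 * n - i"
    and "\<And>i j. i \<le> r \<Longrightarrow> (\<Sum>i'\<le>i. a i' j) \<in> {0, 1}"
    and "\<And>j. (\<Sum>i'\<le>r. a i' j) = of_bool (j \<in> S)"
    and "\<And>i x. i \<in> {1..r} \<Longrightarrow> (\<Sum>j<x. a i j) \<in> {0, 1}"
    and "\<And>i. i \<in> {1..r} \<Longrightarrow> (\<Sum>j<2 * n. a i j) = 1"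
  shows "a \<in> partials n r S"
  unfolding partials_def using assms by blast

lemma partialsD:
  assumes "a \<in> partials n r S"
  shows "a i j \<noteq> 0 \<Longrightarrow> 1 \<le> i \<and> i \<le> r \<and> i \<le> j \<and> j \<le> 2 * n - i"
    and "i \<le> r \<Longrightarrow> (\<Sum>i'\<le>i. a i' j) \<in> {0, 1}"
    and "(\<Sum>i'\<le>r. a i' j) = of_bool (j \<in> S)"
    and "i \<in> {1..r} \<Longrightarrow> (\<Sum>j<x. a i j) \<in> {0, 1}"
    and "i \<in> {1..r} \<Longrightarrow> (\<Sum>j<2 * n. a i j) = 1"
  using assms unfolding partials_def by blast+

text \<open>The set \<open>S'\<close> of columns with sum 1 in the first \<open>r\<close> rows can
  be read off, and with \<open>S\<close> it determines row \<open>r + 1\<close>.\<close>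

lemma partials_Suc:
  "partials n (Suc r) S = (\<Union>S'\<in>{S'. rowrel n (Suc r) S S'}.
    (\<lambda>a. a(Suc r := \<lambda>j. of_bool (j \<in> S) - of_bool (j \<in> S'))) ` partials n r S')"
proof (intro set_eqI iffI)
  fix a assume a: "a \<in> partials n (Suc r) S"
  define S' where "S' = {j. (\<Sum>i\<le>r. a i j) = 1}"
  define b where "b = a(Suc r := \<lambda>_. 0)"
  have S': "(\<Sum>i\<le>r. a i j) = of_bool (j \<in> S')" for j
    using partialsD(2)[OF a, of r j] by (cases "j \<in> S'") (auto simp: S'_def)
  have row: "a (Suc r) j = of_bool (j \<in> S) - of_bool (j \<in> S')" for j
  proof -
    have "(\<Sum>i\<le>Suc r. a i j) = (\<Sum>i\<le>r. a i j) + a (Suc r) j" by simp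
    then show ?thesis unfolding partialsD(3)[OF a] S' by linarith
  qed
  have "rowrel n (Suc r) S S'"
    unfolding rowrel_def row[symmetric]
  proof (intro conjI allI impI)
    fix j assume "j \<notin> {Suc r..2 * n - Suc r}"
    then have "a (Suc r) j = 0" using partialsD(1)[OF a, of "Suc r" j] by auto
    then have "of_bool (j \<in> S) = (of_bool (j \<in> S') :: int)" using row[of j] by linarith
    then show "(j \<in> S) = (j \<in> S')" by (simp only: of_bool_eq_iff)
  next
    show "(\<Sum>j<x. a (Suc r) j) \<in> {0, 1}" for x
      by (rule partialsD(4)[OF a]) simp
    show "(\<Sum>j<2 * n. a (Suc r) j) = 1"
      by (rule partialsD(5)[OF a]) simp
  qed
  moreover have "b \<in> partials n r S'"
  proof (rule partialsI)
    have s: "(\<Sum>i'\<le>i. b i' j) = (\<Sum>i'\<le>i. a i' j)" if "i \<le> r" for i j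
      by (rule sum.cong) (use that in \<open>auto simp: b_def\<close>)
    fix i j :: nat
    show "1 \<le> i \<and> i \<le> r \<and> i \<le> j \<and> j \<le> 2 * n - i" if "b i j \<noteq> 0"
    proof -
      have "i \<noteq> Suc r" "a i j \<noteq> 0" using that by (auto simp: b_def split: if_splits)
      then show ?thesis using partialsD(1)[OF a, of i j] by simp
    qed
    show "(\<Sum>i'\<le>i. b i' j) \<in> {0, 1}" if "i \<le> r"
      unfolding s[OF that] by (rule partialsD(2)[OF a]) (use that in simp)
    show "(\<Sum>i'\<le>r. b i' j) = of_bool (j \<in> S')"
      unfolding s[OF order_refl] by (rule S')
    assume i: "i \<in> {1..r}"
    then have bi: "b i = a i" by (simp add: b_def)
    show "(\<Sum>j<x. b i j) \<in> {0, 1}" for x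
      unfolding bi by (rule partialsD(4)[OF a]) (use i in simp)
    show "(\<Sum>j<2 * n. b i j) = 1"
      unfolding bi by (rule partialsD(5)[OF a]) (use i in simp)
  qed
  moreover have "a = b(Suc r := \<lambda>j. of_bool (j \<in> S) - of_bool (j \<in> S'))"
    unfolding b_def row[symmetric] by simp
  ultimately show "a \<in> (\<Union>S'\<in>{S'. rowrel n (Suc r) S S'}.
    (\<lambda>a. a(Suc r := \<lambda>j. of_bool (j \<in> S) - of_bool (j \<in> S'))) ` partials n r S')" by blast
next
  fix a assume "a \<in> (\<Union>S'\<in>{S'. rowrel n (Suc r) S S'}.
    (\<lambda>a. a(Suc r := \<lambda>j. of_bool (j \<in> S) - of_bool (j \<in> S'))) ` partials n r S')"
  then obtain S' b where rel: "rowrel n (Suc r) S S'" and b: "b \<in> partials n r S'"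
    and a: "a = b(Suc r := \<lambda>j. of_bool (j \<in> S) - of_bool (j \<in> S'))" by blast
  have new: "a (Suc r) = (\<lambda>j. of_bool (j \<in> S) - of_bool (j \<in> S'))" by (simp add: a)
  have old: "a i = b i" if "i \<noteq> Suc r" for i using that by (simp add: a)
  have s: "(\<Sum>i'\<le>i. a i' j) = (\<Sum>i'\<le>i. b i' j)" if "i \<le> r" for i j
    by (rule sum.cong) (use that old in auto)
  have tot: "(\<Sum>i'\<le>Suc r. a i' j) = of_bool (j \<in> S)" for j
    unfolding sum.atMost_Suc s[OF order_refl] partialsD(3)[OF b] new by simp
  show "a \<in> partials n (Suc r) S"
  proof (rule partialsI)
    fix i j :: nat
    show "1 \<le> i \<and> i \<le> Suc r \<and> i \<le> j \<and> j \<le> 2 * n - i" if "a i j \<noteq> 0"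
    proof (cases "i = Suc r")
      case True
      then have "(j \<in> S) \<noteq> (j \<in> S')" using that new by auto
      then have "j \<in> {Suc r..2 * n - Suc r}" using rel unfolding rowrel_def by blast
      then show ?thesis using True by simp
    next
      case False
      then have "b i j \<noteq> 0" using that old[OF False] by simp
      from partialsD(1)[OF b this] show ?thesis by simp
    qed
    show "(\<Sum>i'\<le>i. a i' j) \<in> {0, 1}" if "i \<le> Suc r"
    proof (cases "i = Suc r")
      case True
      then show ?thesis unfolding True tot by simp
    next
      case False
      then have "i \<le> r" using that by simp
      then show ?thesis unfolding s[OF \<open>i \<le> r\<close>] by (rule partialsD(2)[OF b])
    qed
    show "(\<Sum>i'\<le>Suc r. a i' j) = of_bool (j \<in> S)" by (rule tot)
    assume i: "i \<in> {1..Suc r}"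
    show "(\<Sum>j<x. a i j) \<in> {0, 1}" for x
    proof (cases "i = Suc r")
      case True
      then show ?thesis using rel unfolding rowrel_def True new by blast
    next
      case False
      show ?thesis unfolding old[OF False] by (rule partialsD(4)[OF b]) (use i False in simp)
    qed
    show "(\<Sum>j<2 * n. a i j) = 1"
    proof (cases "i = Suc r")
      case True
      then show ?thesis using rel unfolding rowrel_def True new by blast
    next
      case False
      show ?thesis unfolding old[OF False] by (rule partialsD(5)[OF b]) (use i False in simp)
    qed
  qed
qed

lemma card_partials:
  "finite (partials n r S) \<and> int (card (partials n r S)) = chain_count n r S"
proof (induction r arbitrary: S)
  case 0
  show ?case by (simp add: partials_0)
next
  case (Suc r)
  define u where "u S' a = a(Suc r := \<lambda>j. of_bool (j \<in> S) - of_bool (j \<in> S') :: int)"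
    for S' and a :: "nat \<Rightarrow> nat \<Rightarrow> int"
  let ?I = "{S'. rowrel n (Suc r) S S'}"
  have eq: "partials n (Suc r) S = (\<Union>S'\<in>?I. u S' ` partials n r S')"
    unfolding u_def by (rule partials_Suc)
  have inj: "inj_on (u S') (partials n r S')" for S'
  proof (rule inj_onI)
    fix a b assume ab: "a \<in> partials n r S'" "b \<in> partials n r S'" "u S' a = u S' b"
    show "a = b"
    proof (intro ext)
      fix i j
      show "a i j = b i j"
      proof (cases "i = Suc r")
        case True
        have "a (Suc r) j = 0" "b (Suc r) j = 0"
          using partialsD(1)[OF ab(1), of "Suc r" j] partialsD(1)[OF ab(2), of "Suc r" j] by auto
        then show ?thesis using True by simp
      next
        case False
        then show ?thesis using fun_cong[OF ab(3), of i] by (simp add: u_def)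
      qed
    qed
  qed
  \<comment> \<open>Recovering \<open>S'\<close> from the array shows that the union over
    \<open>S'\<close> is disjoint.\<close>
  have rec: "S' = {j. (\<Sum>i\<le>r. a i j) = 1}" if a: "a \<in> u S' ` partials n r S'" for a S'
  proof -
    obtain b where b: "b \<in> partials n r S'" "a = u S' b" using a by blast
    have "(\<Sum>i\<le>r. a i j) = (\<Sum>i\<le>r. b i j)" for j
      by (rule sum.cong) (auto simp: b u_def)
    then show ?thesis unfolding partialsD(3)[OF b(1)] by auto
  qed
  have "card (partials n (Suc r) S) = (\<Sum>S'\<in>?I. card (u S' ` partials n r S'))"
    unfolding eq
  proof (rule card_UN_disjoint)
    show "\<forall>S'\<in>?I. \<forall>T\<in>?I. S' \<noteq> T \<longrightarrow> u S' ` partials n r S' \<inter> u T ` partials n r T = {}"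
    proof (intro ballI impI equals0I)
      fix S' T a assume "S' \<noteq> T" "a \<in> u S' ` partials n r S' \<inter> u T ` partials n r T"
      then show False using rec[of a S'] rec[of a T] by (metis IntD1 IntD2)
    qed
    show "finite ?I" by (rule finite_rowrel)
    show "\<forall>S'\<in>?I. finite (u S' ` partials n r S')" using Suc by blast
  qed
  moreover have "finite (partials n (Suc r) S)"
    unfolding eq using finite_rowrel Suc by blast
  moreover have "int (card (u S' ` partials n r S')) = chain_count n r S'" for S'
    using Suc card_image[OF inj] by metis
  ultimately show ?case by simp
qed

text \<open>If the first non-zero entry were -1, the negated sequence would have partial sums 0 or
  1, contradicting the total 1.\<close>

lemma alternates_sum_lessThan':
  assumes alt: "alternates f" and val: "\<And>i. f i \<in> {0, 1, -1}" and tot: "(\<Sum>i<N. f i) = 1"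
  shows "(\<Sum>i<x. f i) \<in> {0, 1}"
proof (rule alternates_sum_lessThan[OF alt val])
  fix k assume k: "f k \<noteq> 0" "\<forall>i<k. f i = 0"
  show "f k = 1"
  proof (rule ccontr)
    assume "f k \<noteq> 1"
    then have fk: "f k = -1" using val[of k] k(1) by auto
    have "(\<Sum>i<N. - f i) \<in> {0, 1}"
    proof (rule alternates_sum_lessThan)
      show "alternates (\<lambda>i. - f i)"
        using alt unfolding alternates_def neg_equal_0_iff_equal neg_equal_iff_equal .
      show "- f i \<in> {0, 1, -1}" for i using val[of i] by auto
      fix m assume m: "- f m \<noteq> 0" "\<forall>i<m. - f i = 0"
      have "m = k"
        using m k by (metis neg_equal_0_iff_equal nat_neq_iff)
      then show "- f m = 1" using fk by simp
    qed
    then show False using tot by (simp add: sum_negf)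
  qed
qed

text \<open>Partial sums 0 or 1 encode the entries, the alternation and the first sign 1. That sign
  is a defining condition for columns and follows from the row sum for rows.\<close>

lemma AST_iff_partials:
  assumes n: "n \<ge> 1"
  shows "AST n a \<longleftrightarrow> a \<in> partials n n {j. (\<Sum>i\<le>n. a i j) = 1}"
proof
  assume A: "AST n a"
  have supp: "1 \<le> i \<and> i \<le> n \<and> i \<le> j \<and> j \<le> 2 * n - i" if "a i j \<noteq> 0" for i j
    using A that unfolding AST_def triangle_def by blast
  have val: "a i j \<in> {0, 1, -1}" for i j
    using A unfolding AST_def by (cases "(i, j) \<in> triangle n") auto
  have col: "(\<Sum>i<x. a i j) \<in> {0, 1}" for x j
  proof (cases "j \<in> {1..2 * n - 1}")
    case True
    show ?thesis
    proof (rule alternates_sum_lessThan)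
      show "alternates (\<lambda>i. a i j)" using A True unfolding AST_def by blast
      show "a i j \<in> {0, 1, -1}" for i by (rule val)
      fix k assume k: "a k j \<noteq> 0" "\<forall>i<k. a i j = 0"
      then have "(k, j) \<in> triangle n" using A unfolding AST_def by blast
      then show "a k j = 1" using A k unfolding AST_def by blast
    qed
  next
    case False
    have "a i j = 0" for i
    proof (rule ccontr)
      assume "a i j \<noteq> 0"
      from supp[OF this] False show False by auto
    qed
    then show ?thesis by simp
  qed
  show "a \<in> partials n n {j. (\<Sum>i\<le>n. a i j) = 1}"
  proof (rule partialsI)
    show "(\<Sum>i'\<le>i. a i' j) \<in> {0, 1}" for i j
      using col[where x = "Suc i" and j = j] by (simp only: lessThan_Suc_atMost)
    then show "(\<Sum>i\<le>n. a i j) = of_bool (j \<in> {j. (\<Sum>i\<le>n. a i j) = 1})" for j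
      by (cases "(\<Sum>i\<le>n. a i j) = 1") auto
    fix i assume i: "i \<in> {1..n}"
    have "(\<Sum>j = i..2 * n - i. a i j) = (\<Sum>j<2 * n. a i j)"
    proof (rule sum.mono_neutral_left)
      show "{i..2 * n - i} \<subseteq> {..<2 * n}" using i by auto
      show "\<forall>j\<in>{..<2 * n} - {i..2 * n - i}. a i j = 0" using supp by fastforce
    qed simp
    then show tot: "(\<Sum>j<2 * n. a i j) = 1" using A i unfolding AST_def by simp
    show "(\<Sum>j<x. a i j) \<in> {0, 1}" for x
    proof (rule alternates_sum_lessThan'[OF _ _ tot])
      show "alternates (a i)" using A i unfolding AST_def by blast
    qed (rule val)
  qed (rule supp)
next
  assume A: "a \<in> partials n n {j. (\<Sum>i\<le>n. a i j) = 1}"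
  note supp = partialsD(1)[OF A]
  have row0: "a i j = 0" if "i \<notin> {1..n}" for i j
    using supp[of i j] that by auto
  have row: "(\<Sum>j<x. a i j) \<in> {0, 1}" for i x
  proof (cases "i \<in> {1..n}")
    case True
    then show ?thesis by (rule partialsD(4)[OF A])
  qed (simp add: row0)
  have col: "(\<Sum>i<x. a i j) \<in> {0, 1}" for j x
  proof (induction x)
    case (Suc x)
    show ?case
    proof (cases "x \<le> n")
      case True
      then show ?thesis
        unfolding lessThan_Suc_atMost by (rule partialsD(2)[OF A])
    next
      case False
      then show ?thesis using Suc row0[of x j] by simp
    qed
  qed simp
  have tri: "(i, j) \<notin> triangle n \<longrightarrow> a i j = 0" for i j
    using supp[of i j] by (auto simp: triangle_def)
  have tot: "(\<Sum>j = i..2 * n - i. a i j) = 1" if i: "i \<in> {1..n}" for i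
  proof -
    have "(\<Sum>j = i..2 * n - i. a i j) = (\<Sum>j<2 * n. a i j)"
    proof (rule sum.mono_neutral_left)
      show "{i..2 * n - i} \<subseteq> {..<2 * n}" using i by auto
      show "\<forall>j\<in>{..<2 * n} - {i..2 * n - i}. a i j = 0" using supp by fastforce
    qed simp
    also have "\<dots> = 1" by (rule partialsD(5)[OF A i])
    finally show ?thesis .
  qed
  show "AST n a"
    unfolding AST_def
    using tri tot sum_lessThan_value(1)[OF row] alternates_if_sum_lessThan[OF row]
      alternates_if_sum_lessThan[OF col] sum_lessThan_value(2)[OF col]
    by (intro conjI allI ballI) (blast | clarify)+
qed

section \<open>From positions of 1-columns to column sets\<close>

lemma column_at_bij: "n \<ge> 1 \<Longrightarrow> bij_betw (column_at n) {..<2 * n - 2} ({1..<2 * n} - {n})"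
  by (rule bij_betw_byWitness[where f' = "\<lambda>j. if j < n then j - 1 else j - 2"])
    (auto simp: column_at_def)

text \<open>Row \<open>n\<close> has only the central entry, which is therefore 1; a column sum
  confined to 0 and 1 that has just risen by 1 equals 1.\<close>

lemma AST_columns:
  assumes n: "n \<ge> 1" and A: "AST n a" and S: "S = {j. (\<Sum>i\<le>n. a i j) = 1}"
  shows "n \<in> S" "S \<subseteq> {1..<2 * n}" "one_column_positions n a = {p. p < 2 * n - 2 \<and> column_at n p \<in> S}"
proof -
  have P: "a \<in> partials n n S" using AST_iff_partials[OF n] A S by simp
  note supp = partialsD(1)[OF P]
  have z: "a n j = 0" if "j \<noteq> n" for j
    using supp[of n j] that by (cases "a n j = 0") auto
  have "(\<Sum>j<2 * n. a n j) = (\<Sum>j\<in>{n}. a n j)"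
    by (rule sum.mono_neutral_right) (use n z in auto)
  moreover have "(\<Sum>j<2 * n. a n j) = 1" by (rule partialsD(5)[OF P]) (use n in simp)
  ultimately have ann: "a n n = 1" by simp
  obtain m where m: "n = Suc m" using n by (cases n) auto
  have "(\<Sum>i\<le>n. a i n) = (\<Sum>i\<le>m. a i n) + a n n" by (simp add: m)
  moreover have "(\<Sum>i\<le>n. a i n) \<in> {0, 1}" "(\<Sum>i\<le>m. a i n) \<in> {0, 1}"
    by (rule partialsD(2)[OF P]; simp add: m)+
  ultimately show "n \<in> S" unfolding S using ann by auto
  show "S \<subseteq> {1..<2 * n}"
  proof
    fix j assume "j \<in> S"
    then have "(\<Sum>i\<le>n. a i j) \<noteq> 0" unfolding S by simp
    then obtain i where "a i j \<noteq> 0" by (meson sum.neutral)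
    from supp[OF this] n show "j \<in> {1..<2 * n}" by auto
  qed
  have "(\<Sum>i = 1..n. a i j) = (\<Sum>i\<le>n. a i j)" for j
    by (rule sum.mono_neutral_left) (use supp in force)+
  then show "one_column_positions n a = {p. p < 2 * n - 2 \<and> column_at n p \<in> S}"
    by (simp add: one_column_positions_def one_column_def S)
qed

lemma ast_count_eq_chain_count:
  assumes n: "n \<ge> 1" and ks: "set ks \<subseteq> {..<2 * n - 2}"
  shows "int (ast_count n ks) = chain_count n n (insert n (column_at n ` set ks))"
proof -
  define T where "T = insert n (column_at n ` set ks)"
  note bij = column_at_bij[OF n]
  have T: "S = T \<longleftrightarrow> {p. p < 2 * n - 2 \<and> column_at n p \<in> S} = set ks" (is "_ \<longleftrightarrow> ?P = _")
    if S: "n \<in> S" "S \<subseteq> {1..<2 * n}" for S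
  proof
    assume "S = T"
    show "?P = set ks"
    proof (intro set_eqI iffI)
      fix p assume p: "p \<in> ?P"
      then have "column_at n p \<noteq> n" using bij_betwE[OF bij] by auto
      then obtain q where "q \<in> set ks" "column_at n p = column_at n q"
        using p \<open>S = T\<close> unfolding T_def by auto
      moreover have "p \<in> {..<2 * n - 2}" "q \<in> {..<2 * n - 2}"
        using p ks calculation by auto
      ultimately show "p \<in> set ks"
        using bij_betw_imp_inj_on[OF bij] by (metis inj_onD)
    qed (use ks \<open>S = T\<close> T_def in auto)
  next
    assume P: "?P = set ks"
    have "column_at n ` ?P = S - {n}"
    proof (intro set_eqI iffI)
      fix j assume "j \<in> S - {n}"
      then have "j \<in> column_at n ` {..<2 * n - 2}"
        using S(2) bij_betw_imp_surj_on[OF bij] by blast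
      then show "j \<in> column_at n ` ?P" using \<open>j \<in> S - {n}\<close> by auto
    next
      fix j assume "j \<in> column_at n ` ?P"
      then show "j \<in> S - {n}" using bij_betwE[OF bij] by auto
    qed
    then show "S = T" using S(1) unfolding T_def P by blast
  qed
  have "{a. AST n a \<and> one_column_positions n a = set ks} = partials n n T"
  proof (intro set_eqI iffI)
    fix a assume a: "a \<in> {a. AST n a \<and> one_column_positions n a = set ks}"
    define S where "S = {j. (\<Sum>i\<le>n. a i j) = 1}"
    have A: "AST n a" using a by simp
    note c = AST_columns[OF n A S_def]
    have "S = T" using T[OF c(1,2)] c(3) a by simp
    then show "a \<in> partials n n T" using A AST_iff_partials[OF n, of a] unfolding S_def by simp
  next
    fix a assume a: "a \<in> partials n n T"
    have T_eq: "T = {j. (\<Sum>i\<le>n. a i j) = 1}"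
      unfolding partialsD(3)[OF a] by auto
    then have A: "AST n a" using a AST_iff_partials[OF n, of a] by simp
    note c = AST_columns[OF n A T_eq]
    show "a \<in> {a. AST n a \<and> one_column_positions n a = set ks}"
      using T[OF c(1,2)] c(3) A by simp
  qed
  then show ?thesis
    unfolding ast_count_def T_def[symmetric] using card_partials[of n n T] by simp
qed

theorem theorem1p3:
  fixes n :: nat and j :: "nat \<Rightarrow> nat"
  assumes "n \<ge> 1"
    and "strict_mono_on {1..n - 1} j"
    and "\<forall>i \<in> {1..n - 1}. j i \<le> 2 * n - 3"
    and "int (j (n - 1)) < 2 * int n - 3 - int (j 1)"
  shows "int (ast_count n (map j [1..<n])) =
    (\<Sum>l = 2 * n - 3 - j 1..2 * n - 3.
       (-1) ^ (l + 1) * int ((l + 1) choose (2 * n - j 1 - 2)) *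
       int (ast_count n (map j [2..<n] @ [l])))"
proof -
  \<comment> \<open>For \<open>n = 1\<close> the upper bound in the last hypothesis would be
    negative.\<close>
  have n: "n \<ge> 2" using assms(1,4) by (cases "n = 1") auto
  have mono: "j p < j q" if "1 \<le> p" "p < q" "q < n" for p q
    by (rule strict_mono_onD[OF assms(2)]) (use that in auto)
  have j_le: "j q \<le> j (n - 1)" if "1 \<le> q" "q < n" for q
  proof (cases "q = n - 1")
    case False
    then have "q < n - 1" "n - 1 < n" using that by linarith+
    then show ?thesis using mono[of q "n - 1"] that(1) by simp
  qed simp
  have last: "j (n - 1) + j 1 + 3 < 2 * n" using assms(4) by linarith
  have j1: "j 1 + 2 \<le> n" using j_le[of 1] last n by linarith
  define i where "i = j 1 + 1"
  define Q where "Q = j ` {2..<n}"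
  define M where "M = insert n (column_at n ` Q)"
  have i: "1 \<le> i" "i < n" using j1 by (auto simp: i_def)
  have Q: "j 1 < q" "q + j 1 + 3 < 2 * n" if q: "q \<in> Q" for q
  proof -
    obtain p where p: "2 \<le> p" "p < n" "q = j p" using q by (auto simp: Q_def)
    show "j 1 < q" "q + j 1 + 3 < 2 * n"
      using mono[of 1 p] j_le[of p] last p by linarith+
  qed
  have Q_sub: "Q \<subseteq> {..<2 * n - 2}"
  proof
    fix q assume "q \<in> Q"
    from Q(2)[OF this] show "q \<in> {..<2 * n - 2}" by simp
  qed
  \<comment> \<open>All other 1-columns reach below row \<open>i\<close>: on the left because
    \<open>j 1\<close> is the least position, on the right by the bound on
    \<open>j (n - 1)\<close>.\<close>
  have M_sub: "M \<subseteq> {i + 1..<2 * n - i}"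
  proof
    fix c assume "c \<in> M"
    then consider "c = n" | q where "q \<in> Q" "c = column_at n q" unfolding M_def by blast
    then show "c \<in> {i + 1..<2 * n - i}"
    proof cases
      case 2
      then show ?thesis using Q[OF 2(1)] by (auto simp: column_at_def i_def)
    qed (use i in auto)
  qed
  have card_M: "Suc (card M) = n"
  proof -
    have bij: "bij_betw (column_at n) {..<2 * n - 2} ({1..<2 * n} - {n})"
      by (rule column_at_bij) (rule assms(1))
    have "inj_on j {2..<n}"
      by (rule strict_mono_on_imp_inj_on, rule strict_mono_onI) (use mono in auto)
    then have "card Q = n - 2" by (simp add: Q_def card_image)
    moreover have "card (column_at n ` Q) = card Q"
      by (rule card_image) (rule inj_on_subset[OF bij_betw_imp_inj_on[OF bij] Q_sub])
    moreover have "n \<notin> column_at n ` Q"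
      by (auto simp: column_at_def)
    moreover have "finite Q" by (simp add: Q_def)
    ultimately show ?thesis using n by (simp add: M_def)
  qed
  have "int (ast_count n (map j [1..<n])) = chain_count n n (insert i M)"
  proof -
    have set: "set (map j [1..<n]) = insert (j 1) Q"
    proof -
      have "{1..<n} = insert 1 {2..<n}" using n by auto
      then show ?thesis by (simp add: Q_def)
    qed
    have "insert n (column_at n ` insert (j 1) Q) = insert i M"
      using j1 by (auto simp: M_def i_def column_at_def)
    moreover have "set (map j [1..<n]) \<subseteq> {..<2 * n - 2}"
      unfolding set using Q_sub j1 n by auto
    ultimately show ?thesis
      using ast_count_eq_chain_count[OF assms(1), of "map j [1..<n]"] unfolding set by simp
  qed
  also have "\<dots> = (\<Sum>t<i. (-1) ^ (i - 1 + t) * int ((2 * n - i + t - 1) choose t) * chain_count n n (insert (2 * n - i + t) M))"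
    by (rule chain_count_column_swap) (use i M_sub card_M in auto)
  also have "\<dots> = (\<Sum>l = 2 * n - 3 - j 1..2 * n - 3. (-1) ^ (l + 1) * int ((l + 1) choose (2 * n - j 1 - 2)) *
       int (ast_count n (map j [2..<n] @ [l])))"
  proof (rule sum.reindex_bij_witness[where i = "\<lambda>l. l - (2 * n - 3 - j 1)" and j = "\<lambda>t. 2 * n - 3 - j 1 + t"])
    fix t assume t: "t \<in> {..<i}"
    define l where "l = 2 * n - 3 - j 1 + t"
    have "int (ast_count n (map j [2..<n] @ [l])) = chain_count n n (insert (2 * n - i + t) M)"
    proof -
      have set: "set (map j [2..<n] @ [l]) = insert l Q" by (simp add: Q_def)
      \<comment> \<open>Position \<open>l\<close> lies to the right of the central column, so its
        column is \<open>l + 2\<close>.\<close>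
      have "column_at n l = 2 * n - i + t" using j1 n by (auto simp: column_at_def l_def i_def)
      then have "insert n (column_at n ` insert l Q) = insert (2 * n - i + t) M"
        by (auto simp: M_def)
      moreover have "set (map j [2..<n] @ [l]) \<subseteq> {..<2 * n - 2}"
        unfolding set using Q_sub t j1 by (auto simp: l_def i_def)
      ultimately show ?thesis
        using ast_count_eq_chain_count[OF assms(1), of "map j [2..<n] @ [l]"] unfolding set by simp
    qed
    moreover have "(-1 :: int) ^ (l + 1) = (-1) ^ (i - 1 + t)"
    proof -
      have "l + 1 + (i - 1 + t) = 2 * (n - 1 + t)" using j1 by (simp add: l_def i_def)
      then have "even (l + 1) = even (i - 1 + t)" by presburger
      then show ?thesis by (simp only: minus_one_power_iff)
    qed
    moreover have "(l + 1) choose (2 * n - j 1 - 2) = (2 * n - i + t - 1) choose t"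
    proof -
      have "l + 1 = 2 * n - i + t - 1" "2 * n - j 1 - 2 = l + 1 - t" "t \<le> l + 1"
        using j1 by (auto simp: l_def i_def)
      then show ?thesis using binomial_symmetric[of t "l + 1"] by simp
    qed
    ultimately show "(-1) ^ (2 * n - 3 - j 1 + t + 1) * int ((2 * n - 3 - j 1 + t + 1) choose (2 * n - j 1 - 2)) *
        int (ast_count n (map j [2..<n] @ [2 * n - 3 - j 1 + t])) =
      (-1) ^ (i - 1 + t) * int ((2 * n - i + t - 1) choose t) * chain_count n n (insert (2 * n - i + t) M)"
      unfolding l_def[symmetric] by simp
  qed (use j1 in \<open>auto simp: i_def\<close>)
  finally show ?thesis .
qed

end
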